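(* Let $\mathscr{H}$ be a separable Hilbert space and let $A\in\mathscr{L}_{1,\infty}(\mathscr{H})$. Then $A$ is measurable if and only if it is Tauberian. Moreover, in this case $$\int\!\!\!\!\!\!- \; A=\lim_{N\to\infty}\frac{1}{\log N}\sum_{j<N}\lambda_j(A),$$ where $(\lambda_j(A))_{j\ge 0}$ is any eigenvalue sequence of $A$ and $\int\!\!\!\!\!\!-\;A$ denotes the NC integral of $A$.
   Context: For a compact operator $T$ on $\mathscr{H}$, $\mu_j(T)$ ($j\ge 0$) is the $(j+1)$-th eigenvalue of $|T|=\sqrt{T^*T}$, in non-increasing order counted with multiplicity. $\mathscr{L}_{1,\infty}=\mathscr{L}_{1,\infty}(\mathscr{H})$ is the ideal of compact operators with $\mu_j(T)=O(j^{-1})$, with quasi-norm $\|T\|_{1,\infty}=\sup_{j\ge0}(j+1)\mu_j(T)$. An eigenvalue sequence of a compact operator $A$ is a sequence $(\lambda_j(A))_{j\ge0}$ converging to $0$ listing its eigenvalues, each repeated according to algebraic multiplicity (completed by $0$'s if needed), with $|\lambda_0(A)|\ge|\lambda_1(A)|\ge\cdots$; it need not be unique. Let $\ell_\infty$ be the $C^*$-algebra of bounded complex sequences $(a_N)_{N\ge1}$ and $\ell_0$ the closed ideal of sequences converging to $0$. An extended limit $\lim_\omega:\ell_\infty\to\mathbb{C}$ is a state on $\ell_\infty$ (positive linear functional with value $1$ at the constant sequence $1$) that vanishes on $\ell_0$. By convention $(\log N)^{-1}=0$ for $N=1$. For $A\in\mathscr{L}_{1,\infty}$ the Dixmier trace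 associated with $\lim_\omega$ is $\operatorname{Tr}_\omega(A)=\lim_\omega\frac{1}{\log N}\sum_{j<N}\lambda_j(A)$; the sequence is bounded and the value does not depend on the choice of eigenvalue sequence. $A\in\mathscr{L}_{1,\infty}$ is measurable if the value of $\operatorname{Tr}_\omega(A)$ is independent of the extended limit; this common value is then the NC integral $\int\!\!\!\!\!\!-\;A$. $A\in\mathscr{L}_{1,\infty}$ is Tauberian if $\lim_{N\to\infty}\frac{1}{\log N}\sum_{j<N}\lambda_j(A)$ exists for some eigenvalue sequence of $A$; equivalently, it exists, with the same value, for every eigenvalue sequence. *)

theory Defs
  imports "HOL-Analysis.Analysis" "HOL-Library.Landau_Symbols"
begin

text \<open>
  The norm, the topology and completeness come from the underlying real Hilbert space, whose
  inner product is the real part of the complex one. \<open>cinner\<close> is linear in its first argument.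
\<close>

class complex_hilbert_space = real_inner + complete_space +
  fixes scaleC :: "complex \<Rightarrow> 'a \<Rightarrow> 'a"  (infixr \<open>*\<^sub>C\<close> 75)
    and cinner :: "'a \<Rightarrow> 'a \<Rightarrow> complex"
  assumes scaleC_add_right: "c *\<^sub>C (x + y) = c *\<^sub>C x + c *\<^sub>C y"
    and scaleC_add_left: "(c + d) *\<^sub>C x = c *\<^sub>C x + d *\<^sub>C x"
    and scaleC_scaleC: "c *\<^sub>C d *\<^sub>C x = (c * d) *\<^sub>C x"
    and scaleC_of_real: "of_real r *\<^sub>C x = r *\<^sub>R x"
    and cinner_commute: "cinner x y = cnj (cinner y x)"
    and cinner_add_left: "cinner (x + y) z = cinner x z + cinner y z"
    and cinner_scaleC_left: "cinner (c *\<^sub>C x) y = c * cinner x y"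
    and inner_eq_Re_cinner: "inner x y = Re (cinner x y)"

instantiation complex :: complex_hilbert_space
begin

definition scaleC_complex :: "complex \<Rightarrow> complex \<Rightarrow> complex" where
  "scaleC_complex c x = c * x"

definition cinner_complex :: "complex \<Rightarrow> complex \<Rightarrow> complex" where
  "cinner_complex x y = x * cnj y"

instance
  by standard
    (auto simp: scaleC_complex_def cinner_complex_def algebra_simps inner_complex_def
      scaleR_conv_of_real)

end

global_interpretation complex_vector:
  vector_space "scaleC :: complex \<Rightarrow> 'a::complex_hilbert_space \<Rightarrow> 'a"
proof
  show "1 *\<^sub>C x = x" for x :: 'a
    using scaleC_of_real[of 1 x] by simp
qed (simp_all add: scaleC_add_right scaleC_add_left scaleC_scaleC)

abbreviation clinear ::
    "('a::complex_hilbert_space \<Rightarrow> 'b::complex_hilbert_space) \<Rightarrow> bool" where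
  "clinear \<equiv> Vector_Spaces.linear scaleC scaleC"

definition compact_operator :: "('a::complex_hilbert_space \<Rightarrow> 'a) \<Rightarrow> bool" where
  "compact_operator T \<longleftrightarrow> clinear T \<and> compact (closure (T ` cball 0 1))"

text \<open>
  The dimension of the generalised eigenspace. The function \<open>complex_vector.dim\<close> returns \<open>0\<close> on
  infinite-dimensional spaces, but for a compact operator and \<open>z \<noteq> 0\<close> the generalised eigenspace
  is finite-dimensional.
\<close>

definition algebraic_multiplicity ::
    "('a::complex_hilbert_space \<Rightarrow> 'a) \<Rightarrow> complex \<Rightarrow> nat" where
  "algebraic_multiplicity A z =
     complex_vector.dim (\<Union>n. {x. ((\<lambda>y. A y - z *\<^sub>C y) ^^ n) x = 0})"

text \<open>
  Only the nonzero entries are prescribed: if there are finitely many of them, the other conditions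
  force the sequence to be completed by \<open>0\<close>'s; if there are infinitely many, monotonicity of
  the moduli excludes \<open>0\<close> from the list. Convergence to \<open>0\<close> makes each set
  \<open>{j. l j = z}\<close> with \<open>z \<noteq> 0\<close> finite.
\<close>

definition eigenvalue_sequence ::
    "('a::complex_hilbert_space \<Rightarrow> 'a) \<Rightarrow> (nat \<Rightarrow> complex) \<Rightarrow> bool" where
  "eigenvalue_sequence A l \<longleftrightarrow>
     l \<longlonglongrightarrow> 0 \<and> decseq (\<lambda>j. cmod (l j)) \<and>
     (\<forall>z. z \<noteq> 0 \<longrightarrow> card {j. l j = z} = algebraic_multiplicity A z)"

definition some_eigenvalue_sequence ::
    "('a::complex_hilbert_space \<Rightarrow> 'a) \<Rightarrow> nat \<Rightarrow> complex" where
  "some_eigenvalue_sequence A = (SOME l. eigenvalue_sequence A l)"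

definition hilbert_adjoint :: "('a::complex_hilbert_space \<Rightarrow> 'a) \<Rightarrow> 'a \<Rightarrow> 'a" where
  "hilbert_adjoint T = (THE S. \<forall>x y. cinner (T x) y = cinner x (S y))"

definition positive_operator :: "('a::complex_hilbert_space \<Rightarrow> 'a) \<Rightarrow> bool" where
  "positive_operator P \<longleftrightarrow>
     clinear P \<and> bounded_linear P \<and> (\<forall>x. cinner (P x) x \<in> \<real>\<^sub>\<ge>\<^sub>0)"

definition sqrt_operator :: "('a::complex_hilbert_space \<Rightarrow> 'a) \<Rightarrow> 'a \<Rightarrow> 'a" where
  "sqrt_operator S = (THE P. positive_operator P \<and> P \<circ> P = S)"

definition abs_operator :: "('a::complex_hilbert_space \<Rightarrow> 'a) \<Rightarrow> 'a \<Rightarrow> 'a" where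
  "abs_operator T = sqrt_operator (hilbert_adjoint T \<circ> T)"

text \<open>
  The operator \<open>abs_operator T\<close> is positive, so its eigenvalues are nonnegative reals with equal
  algebraic and geometric multiplicities, and it has exactly one eigenvalue sequence.
\<close>

definition singular_value :: "('a::complex_hilbert_space \<Rightarrow> 'a) \<Rightarrow> nat \<Rightarrow> real" where
  "singular_value T j = Re (some_eigenvalue_sequence (abs_operator T) j)"

definition weak_trace_class :: "('a::complex_hilbert_space \<Rightarrow> 'a) set" where
  "weak_trace_class =
     {T. compact_operator T \<and> singular_value T \<in> O(\<lambda>j. 1 / real j)}"

text \<open>
  A state on $\ell_\infty$ is represented by a function on all complex sequences that is constrained
  on the bounded ones only; its other values are irrelevant.
\<close>

definition extended_limit :: "((nat \<Rightarrow> complex) \<Rightarrow> complex) \<Rightarrow> bool" where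
  "extended_limit \<omega> \<longleftrightarrow>
     (\<forall>a b. Bseq a \<longrightarrow> Bseq b \<longrightarrow> \<omega> (\<lambda>n. a n + b n) = \<omega> a + \<omega> b) \<and>
     (\<forall>c a. Bseq a \<longrightarrow> \<omega> (\<lambda>n. c * a n) = c * \<omega> a) \<and>
     (\<forall>a. Bseq a \<longrightarrow> (\<forall>n. a n \<in> \<real>\<^sub>\<ge>\<^sub>0) \<longrightarrow> \<omega> a \<in> \<real>\<^sub>\<ge>\<^sub>0) \<and>
     \<omega> (\<lambda>n. 1) = 1 \<and>
     (\<forall>a. a \<longlonglongrightarrow> 0 \<longrightarrow> \<omega> a = 0)"

text \<open>
  For \<open>N = 1\<close> we have \<open>ln 1 = 0\<close>, so division by zero returning \<open>0\<close> implements the convention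
  $(\log 1)^{-1} = 0$.
\<close>

definition log_mean :: "(nat \<Rightarrow> complex) \<Rightarrow> nat \<Rightarrow> complex" where
  "log_mean l N = (\<Sum>j<N. l j) / of_real (ln (real N))"

text \<open>
  The sequences to which extended limits are applied are indexed by \<open>N \<ge> 1\<close>; the entry with
  index \<open>N\<close> is stored at position \<open>n\<close> with \<open>N = Suc n\<close>.
  The value does not depend on the choice of the eigenvalue sequence.
\<close>

definition dixmier_trace ::
    "((nat \<Rightarrow> complex) \<Rightarrow> complex) \<Rightarrow> ('a::complex_hilbert_space \<Rightarrow> 'a) \<Rightarrow> complex" where
  "dixmier_trace \<omega> A = \<omega> (\<lambda>n. log_mean (some_eigenvalue_sequence A) (Suc n))"

definition nc_measurable :: "('a::complex_hilbert_space \<Rightarrow> 'a) \<Rightarrow> bool" where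
  "nc_measurable A \<longleftrightarrow>
     (\<forall>\<omega> \<omega>'. extended_limit \<omega> \<longrightarrow> extended_limit \<omega>' \<longrightarrow> dixmier_trace \<omega> A = dixmier_trace \<omega>' A)"

definition nc_integral :: "('a::complex_hilbert_space \<Rightarrow> 'a) \<Rightarrow> complex" where
  "nc_integral A = (THE c. \<forall>\<omega>. extended_limit \<omega> \<longrightarrow> dixmier_trace \<omega> A = c)"

definition tauberian :: "('a::complex_hilbert_space \<Rightarrow> 'a) \<Rightarrow> bool" where
  "tauberian A \<longleftrightarrow> (\<exists>l. eigenvalue_sequence A l \<and> convergent (log_mean l))"

end

theory Submission
  imports Defs "Jordan_Normal_Form.Determinant"
begin

text \<open>
  Two facts carry the theorem. The first is that a sequence on which all extended limits agree
  converges. It is bounded, since extended limits are arbitrary at unbounded sequences. If it did not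
  converge to the common value, some subsequence would stay away from this value, and the limit along
  an ultrafilter that lives on this subsequence would be an extended limit with another value
  (\<open>convergent_if_extended_limits_agree\<close>). Hence measurability forces the logarithmic means of the
  chosen eigenvalue sequence to converge, and the converse is the fact that extended limits extend
  the limit.

  The second fact is that the limit does not depend on the eigenvalue sequence. Two eigenvalue
  sequences of the same operator list the same numbers except for the order among eigenvalues of equal
  modulus, so their partial sums up to \<open>N\<close> differ by at most \<open>2 * N * cmod (l N)\<close>
  (\<open>eigenvalue_sequence_partial_sums\<close>). It remains to see that \<open>N * cmod (l N)\<close> is bounded; then
  division by \<open>ln N\<close> makes the difference vanish. The additive inequality
  \<open>(\<Sum>k<N. cmod (l k)) \<le> (\<Sum>k<N. s k)\<close> between eigenvalues and singular values would only give a
  bound of order \<open>ln N\<close>. The multiplicative one, \<open>(\<Prod>k<N. cmod (l k)) \<le> (\<Prod>k<N. s k)\<close>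
  (\<open>weyl_product_inequality\<close>), together with \<open>s k \<le> C / (k + 1)\<close> gives
  \<open>cmod (l (N - 1)) ^ N \<le> C ^ N / fact N\<close> and hence the bound \<open>exp 1 * C\<close> for
  \<open>N * cmod (l (N - 1))\<close>. The same estimate, applied to distinct eigenvalues, shows that the
  eigenvalues accumulate only at \<open>0\<close>, so that an eigenvalue sequence exists.

  The singular values are made accessible by one construction. Choosing successively unit vectors
  \<open>e n\<close> that maximise \<open>norm (T x)\<close> on the complement of the previous ones gives a Schmidt
  decomposition \<open>T x = (\<Sum>n. cinner x (e n) *\<^sub>C T (e n))\<close> with orthogonal \<open>T (e n)\<close>. From it
  one reads off the adjoint, the unique positive square root of the adjoint times \<open>T\<close>, and the
  spectrum of this root: the singular values are the numbers \<open>norm (T (e n))\<close>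
  (\<open>singular_value_eq\<close>).

  Weyl's inequality comes from comparing determinants. On the span of generalised eigenvectors
  \<open>T\<close> is triangular in an orthonormal basis, with the eigenvalues on the diagonal. In another pair of
  orthonormal bases of the same space it is triangular with diagonal entries bounded by the singular
  values; a change of orthonormal basis does not affect the modulus of the determinant.
\<close>

section \<open>Extended limits\<close>

text \<open>
  By Zorn's lemma there is a minimal proper filter below \<open>F\<close>. Meeting a minimal proper filter with
  a set on which it is not eventually false does not change it, so it decides every predicate.
\<close>

lemma ultrafilter_below:
  fixes F :: "'b filter"
  assumes "F \<noteq> bot"
  obtains U where "U \<noteq> bot" "U \<le> F" "\<And>P. eventually P U \<or> eventually (\<lambda>x. \<not> P x) U"
proof -
  let ?A = "{G. G \<noteq> bot \<and> G \<le> F}"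
  have "\<exists>U\<in>?A. \<forall>G\<in>?A. G \<le> U \<longrightarrow> G = U"
  proof (rule predicate_Zorn)
    show "partial_order_on ?A (relation_of (\<lambda>G H. H \<le> G) ?A)"
      by (rule partial_order_on_relation_ofI) auto
    fix C assume C: "C \<in> Chains (relation_of (\<lambda>G H. H \<le> G) ?A)"
    then have CA: "\<And>G. G \<in> C \<Longrightarrow> G \<noteq> bot \<and> G \<le> F"
      and chain: "\<And>G H. G \<in> C \<Longrightarrow> H \<in> C \<Longrightarrow> G \<le> H \<or> H \<le> G"
      unfolding Chains_def relation_of_def by blast+
    show "\<exists>U\<in>?A. \<forall>G\<in>C. U \<le> G"
    proof (cases "C = {}")
      case True
      then show ?thesis using assms by blast
    next
      case False
      have ev: "eventually P (Inf C) \<longleftrightarrow> (\<exists>G\<in>C. eventually P G)" for P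
      proof (rule eventually_Inf_base[OF False])
        show "\<exists>K\<in>C. K \<le> inf G H" if "G \<in> C" "H \<in> C" for G H
          using chain[OF that] that le_inf_iff by blast
      qed
      have "Inf C \<noteq> bot"
        using ev[of "\<lambda>_. False"] CA by (auto simp: trivial_limit_def)
      moreover have "Inf C \<le> F"
        using False CA Inf_lower2 by blast
      ultimately show ?thesis using Inf_lower[of _ C] by blast
    qed
  qed
  then obtain U where U: "U \<noteq> bot" "U \<le> F"
    and minimal: "\<And>G. G \<noteq> bot \<Longrightarrow> G \<le> F \<Longrightarrow> G \<le> U \<Longrightarrow> G = U"
    by blast
  have "eventually P U \<or> eventually (\<lambda>x. \<not> P x) U" for P
  proof (rule ccontr)
    assume neg: "\<not> ?thesis"
    let ?G = "inf U (principal {x. P x})"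
    have "?G \<noteq> bot"
      using neg by (auto simp: trivial_limit_def eventually_inf_principal)
    then have "?G = U"
      using U by (intro minimal) (auto intro: le_infI1)
    moreover have "eventually P ?G" by (simp add: eventually_inf_principal)
    ultimately have "eventually P U" by (rule subst)
    with neg show False by blast
  qed
  with U show ?thesis using that by blast
qed

text \<open>
  A bounded sequence has a cluster point along \<open>U\<close> by compactness, and an ultrafilter converges
  to each of its cluster points.
\<close>

lemma ultrafilter_tendsto:
  fixes a :: "nat \<Rightarrow> complex"
  assumes U: "U \<noteq> bot" "\<And>P. eventually P U \<or> eventually (\<lambda>x. \<not> P x) U"
    and "Bseq a"
  shows "(a \<longlongrightarrow> Lim U a) U"
proof -
  obtain K where K: "\<And>n. norm (a n) \<le> K"
    using \<open>Bseq a\<close> by (auto simp: Bseq_def)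
  let ?F = "filtermap a U"
  have "?F \<noteq> bot" using U(1) by (simp add: filtermap_bot_iff)
  moreover have "eventually (\<lambda>x. x \<in> cball 0 K) ?F"
    by (simp add: eventually_filtermap K)
  ultimately obtain c where c: "inf (nhds c) ?F \<noteq> bot"
    using compact_cball[of "0::complex" K] unfolding compact_filter by blast
  have "(a \<longlongrightarrow> c) U"
  proof (rule topological_tendstoI)
    fix S assume S: "open S" "c \<in> S"
    show "eventually (\<lambda>x. a x \<in> S) U"
    proof (rule ccontr)
      assume "\<not> ?thesis"
      then have "eventually (\<lambda>x. a x \<notin> S) U" using U(2)[of "\<lambda>x. a x \<in> S"] by blast
      then have "eventually (\<lambda>x. x \<notin> S) ?F" by (simp add: eventually_filtermap)
      moreover have "eventually (\<lambda>x. x \<in> S) (nhds c)" using S by (simp add: eventually_nhds_in_open)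
      ultimately have "eventually (\<lambda>x. False) (inf (nhds c) ?F)"
        unfolding eventually_inf by blast
      with c show False by (simp add: trivial_limit_def)
    qed
  qed
  then show ?thesis using tendsto_Lim[OF U(1)] by metis
qed

lemma extended_limit_Lim:
  assumes U: "U \<noteq> bot" "\<And>P. eventually P U \<or> eventually (\<lambda>x. \<not> P x) U"
    and "U \<le> sequentially"
  shows "extended_limit (Lim U)"
proof -
  note conv = ultrafilter_tendsto[OF U]
  have closed: "closed (\<real>\<^sub>\<ge>\<^sub>0 :: complex set)" by simp
  show ?thesis
    unfolding extended_limit_def
  proof (intro conjI allI impI)
    fix a b :: "nat \<Rightarrow> complex" assume "Bseq a" "Bseq b"
    then show "Lim U (\<lambda>n. a n + b n) = Lim U a + Lim U b"
      by (intro tendsto_Lim U(1) tendsto_add conv)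
  next
    fix c and a :: "nat \<Rightarrow> complex" assume "Bseq a"
    then show "Lim U (\<lambda>n. c * a n) = c * Lim U a"
      by (intro tendsto_Lim U(1) tendsto_mult_left conv)
  next
    fix a :: "nat \<Rightarrow> complex" assume "Bseq a" "\<forall>n. a n \<in> \<real>\<^sub>\<ge>\<^sub>0"
    then show "Lim U a \<in> \<real>\<^sub>\<ge>\<^sub>0"
      using Lim_in_closed_set[OF closed _ U(1) conv] by simp
  next
    show "Lim U (\<lambda>n. 1 :: complex) = 1" using U(1) by (intro tendsto_Lim) auto
  next
    fix a :: "nat \<Rightarrow> complex" assume "a \<longlonglongrightarrow> 0"
    then show "Lim U a = 0"
      using \<open>U \<le> sequentially\<close> by (intro tendsto_Lim U(1)) (rule tendsto_mono)
  qed
qed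

lemma extended_limit_exists: "\<exists>\<omega>. extended_limit \<omega>"
  using ultrafilter_below[OF sequentially_bot] extended_limit_Lim by metis

lemma extended_limit_convergent:
  assumes \<omega>: "extended_limit \<omega>" and a: "a \<longlonglongrightarrow> c"
  shows "\<omega> a = c"
proof -
  have add: "\<omega> (\<lambda>n. x n + y n) = \<omega> x + \<omega> y" if "Bseq x" "Bseq y" for x y
    using \<omega> that unfolding extended_limit_def by blast
  have scale: "\<omega> (\<lambda>n. k * x n) = k * \<omega> x" if "Bseq x" for k x
    using \<omega> that unfolding extended_limit_def by blast
  have one: "\<omega> (\<lambda>n. 1) = 1" using \<omega> unfolding extended_limit_def by blast
  have null: "\<omega> x = 0" if "x \<longlonglongrightarrow> 0" for x
    using \<omega> that unfolding extended_limit_def by blast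
  have diff: "(\<lambda>n. a n - c) \<longlonglongrightarrow> 0" using a by (rule LIM_zero)
  have "\<omega> (\<lambda>n. (a n - c) + c) = \<omega> (\<lambda>n. a n - c) + \<omega> (\<lambda>n. c)"
    by (rule add) (use diff in \<open>auto intro!: convergent_imp_Bseq convergentI\<close>)
  also have "\<omega> (\<lambda>n. c) = c" using scale[of "\<lambda>n. 1" c] one by simp
  also have "\<omega> (\<lambda>n. a n - c) = 0" using diff by (rule null)
  finally show ?thesis by simp
qed

text \<open>
  An extended limit is unconstrained outside the bounded sequences, so its value at an unbounded
  sequence can be changed at will.
\<close>

lemma Bseq_if_extended_limits_agree:
  assumes agree: "\<And>\<omega> \<omega>'. extended_limit \<omega> \<Longrightarrow> extended_limit \<omega>' \<Longrightarrow> \<omega> a = \<omega>' a"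
  shows "Bseq a"
proof (rule ccontr)
  assume unbounded: "\<not> Bseq a"
  obtain \<omega> where \<omega>: "extended_limit \<omega>" using extended_limit_exists by blast
  define \<omega>' where "\<omega>' b = (if b = a then \<omega> a + 1 else \<omega> b)" for b
  have eq: "\<omega>' b = \<omega> b" if "Bseq b" for b
    using that unbounded by (auto simp: \<omega>'_def)
  have null: "Bseq b" if "b \<longlonglongrightarrow> 0" for b :: "nat \<Rightarrow> complex"
    using that convergent_imp_Bseq convergentI by blast
  have "extended_limit \<omega>'"
    unfolding extended_limit_def
  proof (intro conjI allI impI)
    fix b b' :: "nat \<Rightarrow> complex" assume b: "Bseq b" "Bseq b'"
    then have "Bseq (\<lambda>n. b n + b' n)"
      by (simp add: Bseq_eq_bounded bounded_plus_comp)
    with b \<omega> show "\<omega>' (\<lambda>n. b n + b' n) = \<omega>' b + \<omega>' b'"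
      unfolding extended_limit_def by (simp only: eq)
  next
    fix c and b :: "nat \<Rightarrow> complex" assume b: "Bseq b"
    then have "Bseq (\<lambda>n. c * b n)" by (intro Bseq_mult) simp_all
    with b \<omega> show "\<omega>' (\<lambda>n. c * b n) = c * \<omega>' b"
      unfolding extended_limit_def by (simp only: eq)
  next
    fix b :: "nat \<Rightarrow> complex" assume "Bseq b" "\<forall>n. b n \<in> \<real>\<^sub>\<ge>\<^sub>0"
    with \<omega> show "\<omega>' b \<in> \<real>\<^sub>\<ge>\<^sub>0" unfolding extended_limit_def by (metis eq)
  next
    show "\<omega>' (\<lambda>n. 1) = 1" using \<omega> eq[of "\<lambda>n. 1"] unfolding extended_limit_def by simp
  next
    fix b :: "nat \<Rightarrow> complex" assume "b \<longlonglongrightarrow> 0"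
    with \<omega> show "\<omega>' b = 0" using eq[OF null] unfolding extended_limit_def by simp
  qed
  from agree[OF \<omega> this] show False by (simp add: \<omega>'_def)
qed

lemma convergent_if_extended_limits_agree:
  assumes agree: "\<And>\<omega> \<omega>'. extended_limit \<omega> \<Longrightarrow> extended_limit \<omega>' \<Longrightarrow> \<omega> a = \<omega>' a"
  shows "convergent a"
proof (rule ccontr)
  assume nonconvergent: "\<not> convergent a"
  obtain \<omega> where \<omega>: "extended_limit \<omega>" using extended_limit_exists by blast
  then have "\<not> a \<longlonglongrightarrow> \<omega> a" using nonconvergent convergentI by blast
  then obtain \<epsilon> where \<epsilon>: "\<epsilon> > 0" "\<not> eventually (\<lambda>n. dist (a n) (\<omega> a) < \<epsilon>) sequentially"
    unfolding tendsto_iff by blast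
  let ?F = "inf sequentially (principal {n. \<not> dist (a n) (\<omega> a) < \<epsilon>})"
  have "?F \<noteq> bot" using \<epsilon>(2) by (simp add: trivial_limit_def eventually_inf_principal)
  from ultrafilter_below[OF this] obtain U where U: "U \<noteq> bot" "U \<le> ?F"
    "\<And>P. eventually P U \<or> eventually (\<lambda>x. \<not> P x) U" by metis
  then have "extended_limit (Lim U)" by (intro extended_limit_Lim) auto
  then have "Lim U a = \<omega> a" using agree \<omega> by blast
  moreover have "Bseq a" using agree by (rule Bseq_if_extended_limits_agree)
  ultimately have "(a \<longlongrightarrow> \<omega> a) U"
    using ultrafilter_tendsto[OF U(1,3)] by metis
  then have near: "eventually (\<lambda>n. dist (a n) (\<omega> a) < \<epsilon>) U" using \<epsilon>(1) by (rule tendstoD)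
  have far: "eventually (\<lambda>n. \<not> dist (a n) (\<omega> a) < \<epsilon>) U"
    using U(2) by (simp add: le_principal)
  have "eventually (\<lambda>n. False) U" using eventually_conj[OF near far] by (rule eventually_mono) blast
  then show False using U(1) by (simp add: trivial_limit_def)
qed

section \<open>Complex Hilbert spaces and linear maps\<close>

instance complex_hilbert_space \<subseteq> banach ..

abbreviation cspan :: "'a::complex_hilbert_space set \<Rightarrow> 'a set" where
  "cspan \<equiv> complex_vector.span"

lemma cinner_add_right: "cinner x (y + z) = cinner x y + cinner x z"
  by (subst (1 2 3) cinner_commute) (simp add: cinner_add_left)

lemma cinner_scaleC_right: "cinner x (c *\<^sub>C y) = cnj c * cinner x y"
  by (subst (1 2) cinner_commute) (simp add: cinner_scaleC_left)

lemma cinner_zero_left [simp]: "cinner 0 x = 0"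
  using cinner_add_left[of 0 0 x] by simp

lemma cinner_zero_right [simp]: "cinner x 0 = 0"
  using cinner_add_right[of x 0 0] by simp

lemma cinner_diff_left: "cinner (x - y) z = cinner x z - cinner y z"
  using cinner_add_left[of "x - y" y z] by simp

lemma cinner_diff_right: "cinner x (y - z) = cinner x y - cinner x z"
  using cinner_add_right[of x "y - z" z] by simp

lemma cinner_sum_left: "cinner (\<Sum>i\<in>I. f i) x = (\<Sum>i\<in>I. cinner (f i) x)"
  by (induction I rule: infinite_finite_induct) (simp_all add: cinner_add_left)

lemma cinner_sum_right: "cinner x (\<Sum>i\<in>I. f i) = (\<Sum>i\<in>I. cinner x (f i))"
  by (induction I rule: infinite_finite_induct) (simp_all add: cinner_add_right)

lemma cinner_eq_0_commute: "cinner x y = 0 \<longleftrightarrow> cinner y x = 0"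
  by (subst cinner_commute) simp

lemma cinner_self: "cinner x x = of_real ((norm x)\<^sup>2)"
proof (rule complex_eqI)
  show "Re (cinner x x) = Re (of_real ((norm x)\<^sup>2))"
    using inner_eq_Re_cinner[of x x] by (simp add: power2_norm_eq_inner)
  have "Im (cinner x x) = Im (cnj (cinner x x))" using cinner_commute[of x x] by simp
  then show "Im (cinner x x) = Im (of_real ((norm x)\<^sup>2))" by simp
qed

lemma cinner_self_eq_0 [simp]: "cinner x x = 0 \<longleftrightarrow> x = 0"
  by (simp add: cinner_self)

lemma norm_scaleC: "norm (c *\<^sub>C x) = cmod c * norm x"
proof -
  have "complex_of_real ((norm (c *\<^sub>C x))\<^sup>2) = c * cnj c * cinner x x"
    by (simp add: cinner_self[symmetric] cinner_scaleC_left cinner_scaleC_right del: of_real_power)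
  also have "\<dots> = complex_of_real ((cmod c * norm x)\<^sup>2)"
    by (simp add: complex_norm_square[symmetric] cinner_self power_mult_distrib)
  finally have "(norm (c *\<^sub>C x))\<^sup>2 = (cmod c * norm x)\<^sup>2"
    by (simp only: of_real_eq_iff)
  then show ?thesis by (simp add: power2_eq_iff_nonneg)
qed

lemma norm_add_orthogonal:
  assumes "cinner x y = 0"
  shows "(norm (x + y))\<^sup>2 = (norm x)\<^sup>2 + (norm y)\<^sup>2"
proof -
  have "inner x y = 0" using assms by (simp add: inner_eq_Re_cinner)
  then show ?thesis by (simp add: power2_norm_eq_inner inner_add_left inner_add_right inner_commute)
qed

lemma cmod_cinner_le: "cmod (cinner x y) \<le> norm x * norm y"
proof -
  obtain u where u: "cmod u = 1" "u * cinner x y = of_real (cmod (cinner x y))"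
  proof (cases "cinner x y = 0")
    case False
    let ?u = "cnj (cinner x y) / of_real (cmod (cinner x y))"
    have "?u * cinner x y = of_real ((cmod (cinner x y))\<^sup>2) / of_real (cmod (cinner x y))"
      by (simp add: complex_norm_square[symmetric] mult.commute)
    also have "\<dots> = of_real (cmod (cinner x y))"
      using False by (simp add: power2_eq_square)
    finally show ?thesis using False that[of ?u] by (simp add: norm_divide)
  qed (use that[of 1] in simp)
  have "cmod (cinner x y) = inner (u *\<^sub>C x) y"
    using u(2) by (simp add: inner_eq_Re_cinner cinner_scaleC_left)
  also have "\<dots> \<le> norm (u *\<^sub>C x) * norm y" by (rule norm_cauchy_schwarz)
  finally show ?thesis by (simp add: norm_scaleC u(1))
qed

lemma bounded_linear_cinner_left: "bounded_linear (\<lambda>x. cinner x y)"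
proof (rule bounded_linear_intro[where K = "norm y"])
  show "cinner (r *\<^sub>R x) y = r *\<^sub>R cinner x y" for r x
    using cinner_scaleC_left[of "of_real r" x y] by (simp add: scaleC_of_real scaleR_conv_of_real)
qed (simp_all add: cinner_add_left cmod_cinner_le)

lemma bounded_linear_cinner_right: "bounded_linear (\<lambda>y. cinner x y)"
proof (rule bounded_linear_intro[where K = "norm x"])
  show "cinner x (r *\<^sub>R y) = r *\<^sub>R cinner x y" for r y
    using cinner_scaleC_right[of x "of_real r" y] by (simp add: scaleC_of_real scaleR_conv_of_real)
  show "cmod (cinner x y) \<le> norm y * norm x" for y
    using cmod_cinner_le[of x y] by (simp add: mult.commute)
qed (simp_all add: cinner_add_right)

lemmas tendsto_cinner_left = bounded_linear.tendsto[OF bounded_linear_cinner_left]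
lemmas tendsto_cinner_right = bounded_linear.tendsto[OF bounded_linear_cinner_right]

lemma eq_if_cinner_left_eq: "(\<And>x. cinner x a = cinner x b) \<Longrightarrow> a = b"
  using cinner_self_eq_0[of "a - b"] by (simp add: cinner_diff_right del: cinner_self_eq_0)

lemma eq_if_cinner_right_eq: "(\<And>x. cinner a x = cinner b x) \<Longrightarrow> a = b"
  using cinner_self_eq_0[of "a - b"] by (simp add: cinner_diff_left del: cinner_self_eq_0)

lemma bounded_linear_scaleC: "bounded_linear (\<lambda>x. c *\<^sub>C x :: 'a::complex_hilbert_space)"
proof (rule bounded_linear_intro[where K = "cmod c"])
  show "c *\<^sub>C (r *\<^sub>R x) = r *\<^sub>R (c *\<^sub>C x)" for r and x :: 'a
    by (simp add: scaleC_of_real[symmetric] scaleC_scaleC mult.commute)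
qed (simp_all add: scaleC_add_right norm_scaleC)

lemma clinear_add: "clinear T \<Longrightarrow> T (x + y) = T x + T y"
  by (simp add: Vector_Spaces.linear_iff)

lemma clinear_scaleC: "clinear T \<Longrightarrow> T (c *\<^sub>C x) = c *\<^sub>C T x"
  by (simp add: Vector_Spaces.linear_iff)

lemma clinear_0: "clinear T \<Longrightarrow> T 0 = 0"
  using clinear_add[of T 0 0] by simp

lemma clinear_diff: "clinear T \<Longrightarrow> T (x - y) = T x - T y"
  using clinear_add[of T "x - y" y] by simp

lemma clinear_sum: "clinear T \<Longrightarrow> T (\<Sum>i\<in>I. f i) = (\<Sum>i\<in>I. T (f i))"
  by (induction I rule: infinite_finite_induct) (simp_all add: clinear_add clinear_0)

lemma clinearI:
  assumes "\<And>x y. T (x + y) = T x + T y" "\<And>c x. T (c *\<^sub>C x) = c *\<^sub>C T x"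
  shows "clinear T"
  unfolding Vector_Spaces.linear_iff
  by (intro conjI allI assms complex_vector.vector_space_axioms)

lemma clinear_imp_bounded_linear:
  assumes "clinear T" "\<And>x. norm (T x) \<le> K * norm x"
  shows "bounded_linear T"
proof (rule bounded_linear_intro)
  show "T (r *\<^sub>R x) = r *\<^sub>R T x" for r x
    using clinear_scaleC[OF assms(1)] by (simp add: scaleC_of_real[symmetric])
  show "norm (T x) \<le> norm x * K" for x using assms(2)[of x] by (simp add: mult.commute)
qed (rule clinear_add[OF assms(1)])

lemma compact_operator_bounded:
  assumes "compact_operator T"
  obtains K where "\<And>x. norm (T x) \<le> K * norm x"
proof -
  have lin: "clinear T" and "bounded (closure (T ` cball 0 1))"
    using assms by (auto simp: compact_operator_def compact_imp_bounded)
  then have "bounded (T ` cball 0 1)" using bounded_subset closure_subset by blast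
  then obtain K where K: "\<And>x. norm x \<le> 1 \<Longrightarrow> norm (T x) \<le> K"
    unfolding bounded_iff by (metis imageI mem_cball_0)
  have "norm (T x) \<le> K * norm x" for x
  proof (cases "x = 0")
    case False
    let ?y = "of_real (1 / norm x) *\<^sub>C x"
    have "norm (T ?y) \<le> K" using False by (intro K) (simp add: norm_scaleC norm_divide)
    then show ?thesis using False
      by (simp add: clinear_scaleC[OF lin] norm_scaleC norm_divide field_simps)
  qed (simp add: clinear_0[OF lin])
  with that show ?thesis by blast
qed

lemma cinner_cspan_eq_0:
  assumes "\<And>b. b \<in> B \<Longrightarrow> cinner x b = 0" "y \<in> cspan B"
  shows "cinner x y = 0"
  using assms(2)
  by (induction rule: complex_vector.span_induct_alt)
     (simp_all add: assms(1) cinner_add_right cinner_scaleC_right)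

text \<open>
  Orthogonal projection onto a finite-dimensional subspace, by Gram--Schmidt: the projection onto the
  span of \<open>B\<close> is corrected in the direction of the part of the new vector orthogonal to \<open>B\<close>.
\<close>

lemma finite_orthogonal_decomposition:
  assumes "finite B"
  shows "\<exists>y\<in>cspan B. \<forall>b\<in>cspan B. cinner (x - y) b = 0"
proof -
  have "\<exists>y\<in>cspan B. \<forall>b\<in>B. cinner (x - y) b = 0"
    using assms
  proof (induction B arbitrary: x rule: finite_induct)
    case empty
    then show ?case using complex_vector.span_zero by blast
  next
    case (insert a B)
    obtain y where y: "y \<in> cspan B" "\<And>b. b \<in> B \<Longrightarrow> cinner (x - y) b = 0"
      using insert.IH by blast
    obtain p where p: "p \<in> cspan B" "\<And>b. b \<in> B \<Longrightarrow> cinner (a - p) b = 0"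
      using insert.IH by blast
    define q where "q = a - p"
    have q_span: "q \<in> cspan (insert a B)" unfolding q_def
      by (meson complex_vector.span_base complex_vector.span_diff complex_vector.span_mono
          insertI1 p(1) subset_insertI subsetD)
    \<comment> \<open>If \<open>q = 0\<close>, division by zero makes the coefficient \<open>0\<close>, which is right: \<open>a\<close> is then in
      the span of \<open>B\<close>.\<close>
    define c where "c = cinner (x - y) q / cinner q q"
    have "y + c *\<^sub>C q \<in> cspan (insert a B)"
      using q_span y(1) complex_vector.span_mono[of B "insert a B"]
      by (intro complex_vector.span_add complex_vector.span_scale) auto
    moreover have "cinner (x - (y + c *\<^sub>C q)) b = 0" if b: "b \<in> insert a B" for b
    proof -
      have orth: "cinner (x - (y + c *\<^sub>C q)) d = 0" if "d \<in> B" for d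
        using y(2)[OF that] p(2)[OF that]
        by (simp add: cinner_diff_left cinner_add_left cinner_scaleC_left q_def)
      have "cinner (x - (y + c *\<^sub>C q)) q = 0"
        by (cases "q = 0") (simp_all add: cinner_diff_left cinner_add_left cinner_scaleC_left c_def)
      moreover have "cinner (x - (y + c *\<^sub>C q)) p = 0"
        by (rule cinner_cspan_eq_0[OF orth p(1)])
      ultimately have "cinner (x - (y + c *\<^sub>C q)) (q + p) = 0"
        by (simp add: cinner_add_right)
      then have "cinner (x - (y + c *\<^sub>C q)) a = 0" by (simp add: q_def)
      with orth b show ?thesis by blast
    qed
    ultimately show ?case by blast
  qed
  then show ?thesis using cinner_cspan_eq_0 by blast
qed

definition orthonormal_upto :: "nat \<Rightarrow> (nat \<Rightarrow> 'a::complex_hilbert_space) \<Rightarrow> bool" where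
  "orthonormal_upto N f \<longleftrightarrow> (\<forall>i<N. \<forall>j<N. cinner (f i) (f j) = (if i = j then 1 else 0))"

lemma orthonormal_uptoD:
  "orthonormal_upto N f \<Longrightarrow> i < N \<Longrightarrow> j < N \<Longrightarrow> cinner (f i) (f j) = (if i = j then 1 else 0)"
  by (simp add: orthonormal_upto_def)

lemma norm_eq_1_iff_cinner: "norm x = 1 \<longleftrightarrow> cinner x x = 1"
proof -
  have "cinner x x = 1 \<longleftrightarrow> (norm x)\<^sup>2 = 1\<^sup>2"
    unfolding cinner_self by (simp flip: of_real_power)
  also have "\<dots> \<longleftrightarrow> norm x = 1" by (rule power2_eq_iff_nonneg) auto
  finally show ?thesis by blast
qed

lemma orthonormal_uptoI:
  assumes unit: "\<And>i. i < N \<Longrightarrow> norm (f i) = 1"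
    and orth: "\<And>i j. j < i \<Longrightarrow> i < N \<Longrightarrow> cinner (f i) (f j) = 0"
  shows "orthonormal_upto N f"
  unfolding orthonormal_upto_def
proof (intro allI impI)
  fix i j assume "i < N" "j < N"
  then show "cinner (f i) (f j) = (if i = j then 1 else 0)"
    using unit norm_eq_1_iff_cinner orth[of j i] orth[of i j] cinner_eq_0_commute[of "f i" "f j"]
    by (cases i j rule: linorder_cases) auto
qed

lemma orthonormal_expansion:
  assumes f: "orthonormal_upto N f" and x: "x \<in> cspan (f ` {..<N})"
  shows "x = (\<Sum>i<N. cinner x (f i) *\<^sub>C f i)"
  using x
proof (induction rule: complex_vector.span_induct_alt)
  case (step c b x)
  then obtain k where k: "k < N" "b = f k" by auto
  have "(\<Sum>i<N. cinner (c *\<^sub>C b + x) (f i) *\<^sub>C f i) =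
      (\<Sum>i<N. if i = k then c *\<^sub>C f k else 0) + (\<Sum>i<N. cinner x (f i) *\<^sub>C f i)"
    unfolding sum.distrib[symmetric]
    by (rule sum.cong)
      (use k orthonormal_uptoD[OF f] in \<open>auto simp: cinner_add_left cinner_scaleC_left scaleC_add_left\<close>)
  with k step show ?case by simp
qed simp

lemma orthonormal_parseval:
  assumes "orthonormal_upto N f" "x \<in> cspan (f ` {..<N})"
  shows "cinner x y = (\<Sum>i<N. cinner x (f i) * cinner (f i) y)"
  by (subst orthonormal_expansion[OF assms]) (simp add: cinner_sum_left cinner_scaleC_left)

lemma orthonormal_independent:
  assumes f: "orthonormal_upto N f"
  shows "complex_vector.independent (f ` {..<N})" "inj_on f {..<N}"
proof -
  show inj: "inj_on f {..<N}"
    using f by (intro inj_onI) (metis lessThan_iff orthonormal_upto_def zero_neq_one)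
  show "complex_vector.independent (f ` {..<N})"
    unfolding complex_vector.dependent_def
  proof (clarsimp)
    fix k assume k: "k < N" "f k \<in> cspan (f ` {..<N} - {f k})"
    have "cinner (f k) (f k) = 0"
      using k f by (intro cinner_cspan_eq_0[OF _ k(2)]) (auto simp: orthonormal_upto_def)
    with k f show False by (simp add: orthonormal_upto_def)
  qed
qed

text \<open>
  A homogeneous linear system with fewer equations than unknowns has a nontrivial solution. The
  projections \<open>p w\<close> of the vectors in \<open>W\<close> are too few to span all \<open>f i\<close>, so the part of some
  \<open>f k\<close> orthogonal to these projections does not vanish.
\<close>

lemma unit_vector_orthogonal_to_few:
  assumes f: "orthonormal_upto N f" and W: "finite W" "card W < N"
  obtains x where "norm x = 1" "x \<in> cspan (f ` {..<N})" "\<And>w. w \<in> W \<Longrightarrow> cinner x w = 0"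
proof -
  let ?V = "cspan (f ` {..<N})"
  define p where "p w = (\<Sum>i<N. cinner w (f i) *\<^sub>C f i)" for w
  have pV: "p w \<in> ?V" for w unfolding p_def
    by (intro complex_vector.span_sum complex_vector.span_scale complex_vector.span_base) auto
  have "\<not> f ` {..<N} \<subseteq> cspan (p ` W)"
  proof
    assume "f ` {..<N} \<subseteq> cspan (p ` W)"
    then have "card (f ` {..<N}) \<le> card (p ` W)"
      using complex_vector.independent_span_bound[OF _ orthonormal_independent(1)[OF f]] W by blast
    also have "\<dots> \<le> card W" using W by (intro card_image_le)
    finally show False using W orthonormal_independent(2)[OF f] by (simp add: card_image)
  qed
  then obtain k where k: "k < N" "f k \<notin> cspan (p ` W)" by auto
  obtain y where y: "y \<in> cspan (p ` W)" "\<And>b. b \<in> cspan (p ` W) \<Longrightarrow> cinner (f k - y) b = 0"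
    using finite_orthogonal_decomposition W by (metis finite_imageI)
  define z where "z = f k - y"
  have z: "z \<noteq> 0" using k(2) y(1) by (auto simp: z_def)
  have "cspan (p ` W) \<subseteq> ?V"
    using pV by (intro complex_vector.span_minimal) auto
  then have zV: "z \<in> ?V" unfolding z_def using y(1) k(1)
    by (intro complex_vector.span_diff) (auto intro: complex_vector.span_base)
  have orth: "cinner z w = 0" if "w \<in> W" for w
  proof -
    have "cinner z w = (\<Sum>i<N. cinner z (f i) * cinner (f i) w)"
      by (rule orthonormal_parseval[OF f zV])
    also have "\<dots> = cinner z (p w)"
      by (simp add: p_def cinner_sum_right cinner_scaleC_right mult.commute cinner_commute[of _ w])
    also have "\<dots> = 0" unfolding z_def using that by (intro y(2) complex_vector.span_base) auto
    finally show ?thesis .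
  qed
  show ?thesis
  proof (rule that)
    show "norm (of_real (1 / norm z) *\<^sub>C z) = 1" using z by (simp add: norm_scaleC norm_divide)
    show "of_real (1 / norm z) *\<^sub>C z \<in> ?V" using zV by (rule complex_vector.span_scale)
    show "cinner (of_real (1 / norm z) *\<^sub>C z) w = 0" if "w \<in> W" for w
      using orth[OF that] by (simp add: cinner_scaleC_left)
  qed
qed

section \<open>Positive operators\<close>

text \<open>
  Polarisation: the quadratic form is real at \<open>x + y\<close> and at \<open>x + \<i> y\<close>, which gives the
  imaginary and the real part of the claim.
\<close>

lemma positive_operator_symmetric:
  assumes "positive_operator Q"
  shows "cinner (Q x) y = cinner x (Q y)"
proof -
  have Q: "clinear Q" using assms by (simp add: positive_operator_def)
  have real: "Im (cinner (Q v) v) = 0" for v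
    using assms by (auto simp: positive_operator_def complex_nonneg_Reals_iff)
  have "Im (cinner (Q x) y) + Im (cinner (Q y) x) = 0"
    using real[of "x + y"] real[of x] real[of y]
    by (simp add: clinear_add[OF Q] cinner_add_left cinner_add_right)
  moreover have "Re (cinner (Q y) x) - Re (cinner (Q x) y) = 0"
    using real[of "x + \<i> *\<^sub>C y"] real[of x] real[of y]
    by (simp add: clinear_add[OF Q] clinear_scaleC[OF Q] cinner_add_left cinner_add_right
        cinner_scaleC_left cinner_scaleC_right)
  ultimately have "cinner (Q x) y = cnj (cinner (Q y) x)" by (intro complex_eqI) auto
  then show ?thesis by (simp add: cinner_commute[of x "Q y"])
qed

lemma positive_operator_eigenvalue:
  assumes "positive_operator Q" "Q v = z *\<^sub>C v" "v \<noteq> 0"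
  shows "z \<in> \<real>\<^sub>\<ge>\<^sub>0"
proof -
  have "cinner (Q v) v = z * of_real ((norm v)\<^sup>2)"
    using assms(2) by (simp add: cinner_scaleC_left cinner_self)
  moreover have "cinner (Q v) v \<in> \<real>\<^sub>\<ge>\<^sub>0" using assms(1) by (simp add: positive_operator_def)
  ultimately show ?thesis using assms(3)
    by (auto simp: complex_nonneg_Reals_iff zero_le_mult_iff simp flip: of_real_power)
qed

section \<open>Eigenvalue sequences of the same operator\<close>

text \<open>
  Sums over the entries in a set of nonzero values depend on the operator only. With the constant
  \<open>1\<close> as summand this counts entries; with the identity it sums them.
\<close>

lemma eigenvalue_sequence_sum:
  fixes g :: "complex \<Rightarrow> 'b::semiring_1"
  assumes l: "eigenvalue_sequence A l" and S: "0 \<notin> S" and fin: "finite {j. l j \<in> S}"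
  shows "(\<Sum>j | l j \<in> S. g (l j)) =
    (\<Sum>z | z \<in> S \<and> 0 < algebraic_multiplicity A z. of_nat (algebraic_multiplicity A z) * g z)"
proof -
  let ?J = "{j. l j \<in> S}"
  have card: "card {j. l j = z} = algebraic_multiplicity A z" if "z \<in> S" for z
    using l S that unfolding eigenvalue_sequence_def by metis
  have sub: "finite {j. l j = z}" if "z \<in> S" for z
    using that by (auto intro: finite_subset[OF _ fin])
  have image: "l ` ?J = {z. z \<in> S \<and> 0 < algebraic_multiplicity A z}"
  proof (intro equalityI subsetI)
    fix z assume "z \<in> l ` ?J"
    then obtain j where j: "z = l j" "z \<in> S" by auto
    then have "card {i. l i = z} > 0" using sub by (auto simp: card_gt_0_iff)
    with j card show "z \<in> {z. z \<in> S \<and> 0 < algebraic_multiplicity A z}" by simp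
  next
    fix z assume z: "z \<in> {z. z \<in> S \<and> 0 < algebraic_multiplicity A z}"
    then have "card {i. l i = z} > 0" using card by simp
    then have "{i. l i = z} \<noteq> {}" by (metis card.empty less_numeral_extra(3))
    with z show "z \<in> l ` ?J" by auto
  qed
  have "(\<Sum>j\<in>?J. g (l j)) = (\<Sum>z\<in>l ` ?J. \<Sum>j | j \<in> ?J \<and> l j = z. g (l j))"
    by (rule sum.image_gen[OF fin])
  also have "\<dots> = (\<Sum>z\<in>l ` ?J. of_nat (algebraic_multiplicity A z) * g z)"
  proof (rule sum.cong[OF refl])
    fix z assume "z \<in> l ` ?J"
    then have z: "z \<in> S" by auto
    then have "{j. j \<in> ?J \<and> l j = z} = {j. l j = z}" by auto
    then show "(\<Sum>j | j \<in> ?J \<and> l j = z. g (l j)) = of_nat (algebraic_multiplicity A z) * g z"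
      using card[OF z] by simp
  qed
  finally show ?thesis unfolding image .
qed

lemma eigenvalue_sequence_finite:
  assumes "eigenvalue_sequence A l" "0 < t"
  shows "finite {j. t \<le> cmod (l j)}"
proof -
  have "eventually (\<lambda>j. norm (l j) < t) sequentially"
    using assms by (auto simp: eigenvalue_sequence_def dest: tendstoD)
  then obtain n where "\<And>j. j \<ge> n \<Longrightarrow> cmod (l j) < t" by (auto simp: eventually_sequentially)
  then have "{j. t \<le> cmod (l j)} \<subseteq> {..<n}" by (auto simp: not_less[symmetric])
  then show ?thesis using finite_subset by blast
qed

text \<open>
  For \<open>t = cmod (l n)\<close>, at least \<open>n + 1\<close> entries of \<open>l\<close> have modulus at least \<open>t\<close>, and \<open>l'\<close>
  has equally many such entries; by monotonicity the one with index \<open>n\<close> is among them.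
\<close>

lemma eigenvalue_sequence_cmod_le:
  assumes l: "eigenvalue_sequence A l" and l': "eigenvalue_sequence A l'"
  shows "cmod (l n) \<le> cmod (l' n)"
proof (rule ccontr)
  assume less: "\<not> cmod (l n) \<le> cmod (l' n)"
  define t where "t = cmod (l n)"
  have t: "t > 0" using less norm_ge_zero[of "l' n"] unfolding t_def by linarith
  let ?S = "{z. t \<le> cmod z}"
  have "(\<Sum>j | l j \<in> ?S. 1::nat) = (\<Sum>j | l' j \<in> ?S. 1::nat)"
    using eigenvalue_sequence_sum[OF l, of ?S "\<lambda>_. 1::nat"]
      eigenvalue_sequence_sum[OF l', of ?S "\<lambda>_. 1::nat"] t
      eigenvalue_sequence_finite[OF l t] eigenvalue_sequence_finite[OF l' t] by simp
  then have card_eq: "card {j. t \<le> cmod (l j)} = card {j. t \<le> cmod (l' j)}" by simp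
  have "{..n} \<subseteq> {j. t \<le> cmod (l j)}"
    using l by (auto simp: t_def eigenvalue_sequence_def decseq_def)
  from card_mono[OF eigenvalue_sequence_finite[OF l t] this]
  have "Suc n \<le> card {j. t \<le> cmod (l j)}" by simp
  moreover have "{j. t \<le> cmod (l' j)} \<subseteq> {..<n}"
  proof
    fix j assume "j \<in> {j. t \<le> cmod (l' j)}"
    then have "cmod (l' n) < cmod (l' j)" using less by (auto simp: t_def)
    then have "\<not> n \<le> j" using l' by (auto simp: eigenvalue_sequence_def decseq_def not_le[symmetric])
    then show "j \<in> {..<n}" by simp
  qed
  from card_mono[OF _ this] have "card {j. t \<le> cmod (l' j)} \<le> n" by simp
  ultimately show False using card_eq by simp
qed

lemma eigenvalue_sequence_cmod_eq:
  assumes "eigenvalue_sequence A l" "eigenvalue_sequence A l'"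
  shows "cmod (l n) = cmod (l' n)"
  using assms by (intro antisym eigenvalue_sequence_cmod_le)

section \<open>Schmidt decomposition of a compact operator\<close>

text \<open>
  The vectors \<open>e n\<close> are successive maximisers of \<open>norm (T x)\<close> on the unit ball of the complement of
  the earlier ones. If \<open>T\<close> vanishes on this complement, in particular if the space is exhausted,
  \<open>e n\<close> is \<open>0\<close>. With this convention the sequence is always infinite, and \<open>e n = 0\<close>
  is equivalent to \<open>norm (T (e n)) = 0\<close>.
\<close>

locale schmidt_system =
  fixes T :: "'a::complex_hilbert_space \<Rightarrow> 'a" and e :: "nat \<Rightarrow> 'a"
  assumes T_compact: "compact_operator T"
    and unit_or_0: "\<And>n. norm (e n) = 1 \<or> e n = 0"
    and T_e_nonzero: "\<And>n. T (e n) = 0 \<Longrightarrow> e n = 0"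
    and orthogonal_less: "\<And>n i. i < n \<Longrightarrow> cinner (e n) (e i) = 0"
    and extremal: "\<And>n x. (\<And>i. i < n \<Longrightarrow> cinner x (e i) = 0) \<Longrightarrow>
          norm (T x) \<le> norm (T (e n)) * norm x"
begin

definition s :: "nat \<Rightarrow> real" where
  "s n = norm (T (e n))"

definition partial_expansion :: "nat \<Rightarrow> 'a \<Rightarrow> 'a" where
  "partial_expansion n x = (\<Sum>i<n. cinner x (e i) *\<^sub>C e i)"

lemma T_clinear: "clinear T"
  using T_compact by (simp add: compact_operator_def)

lemma s_nonneg: "0 \<le> s n" by (simp add: s_def)

lemma s_pos: "e n \<noteq> 0 \<Longrightarrow> 0 < s n"
  using T_e_nonzero by (auto simp: s_def)

lemma s_eq_0_iff: "s n = 0 \<longleftrightarrow> e n = 0"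
  using T_e_nonzero clinear_0[OF T_clinear] by (auto simp: s_def)

lemma orthogonal: "i \<noteq> j \<Longrightarrow> cinner (e i) (e j) = 0"
  using orthogonal_less cinner_eq_0_commute by (metis nat_neq_iff)

lemma norm_T_le: "norm (T x) \<le> s 0 * norm x"
  using extremal[of 0 x] by (simp add: s_def)

lemma decseq_s: "decseq s"
proof (rule decseq_SucI)
  fix n
  have "s (Suc n) \<le> s n * norm (e (Suc n))"
    unfolding s_def by (rule extremal) (simp add: orthogonal_less)
  also have "\<dots> \<le> s n" using unit_or_0[of "Suc n"] s_nonneg[of n] by auto
  finally show "s (Suc n) \<le> s n" .
qed

lemma partial_expansion_cinner:
  assumes "k < n" shows "cinner (partial_expansion n x) (e k) = cinner x (e k)"
proof -
  have "cinner (partial_expansion n x) (e k) = (\<Sum>i<n. if i = k then cinner x (e k) else 0)"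
    unfolding partial_expansion_def cinner_sum_left
    using unit_or_0[of k] norm_eq_1_iff_cinner[of "e k"]
    by (intro sum.cong) (auto simp: cinner_scaleC_left orthogonal)
  with assms show ?thesis by simp
qed

lemma remainder_orthogonal: "k < n \<Longrightarrow> cinner (x - partial_expansion n x) (e k) = 0"
  by (simp add: cinner_diff_left partial_expansion_cinner)

lemma norm_remainder_le: "norm (x - partial_expansion n x) \<le> norm x"
proof -
  have "cinner (x - partial_expansion n x) (partial_expansion n x) = 0"
    unfolding partial_expansion_def[of n x, THEN arg_cong[of _ _ "cinner (x - partial_expansion n x)"]]
    by (simp add: cinner_sum_right cinner_scaleC_right remainder_orthogonal)
  from norm_add_orthogonal[OF this]
  have "(norm (x - partial_expansion n x))\<^sup>2 \<le> (norm x)\<^sup>2" by simp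
  then show ?thesis by (rule power2_le_imp_le) simp
qed

lemma norm_T_remainder_le: "norm (T (x - partial_expansion n x)) \<le> s n * norm x"
proof -
  have "norm (T (x - partial_expansion n x)) \<le> s n * norm (x - partial_expansion n x)"
    unfolding s_def by (rule extremal) (rule remainder_orthogonal)
  also have "\<dots> \<le> s n * norm x"
    by (intro mult_left_mono norm_remainder_le s_nonneg)
  finally show ?thesis .
qed

text \<open>First-order condition at the maximiser \<open>e n\<close> of \<open>norm (T x)\<close> on the unit ball of the
  complement of \<open>e 0, \<dots>, e (n - 1)\<close>.\<close>

lemma T_e_orthogonal_T:
  assumes h: "\<And>i. i \<le> n \<Longrightarrow> cinner h (e i) = 0"
  shows "cinner (T (e n)) (T h) = 0"
proof (cases "e n = 0")
  case False
  let ?w = "cinner (T (e n)) (T h)"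
  define K where "K = (s n)\<^sup>2 * (norm h)\<^sup>2"
  have K: "K \<ge> 0" by (simp add: K_def)
  \<comment> \<open>Moving from \<open>e n\<close> by \<open>\<epsilon> * ?w\<close> times \<open>h\<close> changes \<open>norm (T x)\<close> to first order in \<open>\<epsilon>\<close>
    unless \<open>?w = 0\<close>, while maximality allows only a change of second order.\<close>
  have ineq: "2 * \<epsilon> * (cmod ?w)\<^sup>2 \<le> \<epsilon>\<^sup>2 * (cmod ?w)\<^sup>2 * K" for \<epsilon> :: real
  proof -
    define c where "c = of_real \<epsilon> * ?w"
    have "norm (T (e n + c *\<^sub>C h)) \<le> s n * norm (e n + c *\<^sub>C h)"
      unfolding s_def
      by (rule extremal) (use h in \<open>simp add: cinner_add_left cinner_scaleC_left orthogonal\<close>)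
    then have "(norm (T (e n + c *\<^sub>C h)))\<^sup>2 \<le> (s n)\<^sup>2 * (norm (e n + c *\<^sub>C h))\<^sup>2"
      by (metis norm_ge_zero power_mono power_mult_distrib)
    also have "(norm (e n + c *\<^sub>C h))\<^sup>2 = 1 + (cmod c)\<^sup>2 * (norm h)\<^sup>2"
      using h[of n] False unit_or_0[of n] cinner_eq_0_commute[of h "e n"]
      by (subst norm_add_orthogonal)
         (auto simp: cinner_scaleC_right norm_scaleC power_mult_distrib)
    finally have "(norm (T (e n + c *\<^sub>C h)))\<^sup>2 \<le> (s n)\<^sup>2 + (cmod c)\<^sup>2 * K"
      by (simp add: K_def algebra_simps)
    moreover have "(norm (T (e n + c *\<^sub>C h)))\<^sup>2 = (s n)\<^sup>2 + 2 * Re (cinner (T (e n)) (c *\<^sub>C T h)) + (norm (c *\<^sub>C T h))\<^sup>2"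
      unfolding clinear_add[OF T_clinear] clinear_scaleC[OF T_clinear] s_def inner_eq_Re_cinner[symmetric]
      by (simp add: power2_norm_eq_inner inner_add_left inner_add_right inner_commute)
    moreover have "Re (cinner (T (e n)) (c *\<^sub>C T h)) = \<epsilon> * (cmod ?w)\<^sup>2"
    proof -
      have "cinner (T (e n)) (c *\<^sub>C T h) = of_real \<epsilon> * (?w * cnj ?w)"
        by (simp add: cinner_scaleC_right c_def)
      also have "\<dots> = of_real (\<epsilon> * (cmod ?w)\<^sup>2)" by (simp add: complex_norm_square[symmetric])
      finally show ?thesis by simp
    qed
    moreover have "(cmod c)\<^sup>2 * K = \<epsilon>\<^sup>2 * (cmod ?w)\<^sup>2 * K"
      by (simp add: c_def norm_mult power_mult_distrib)
    ultimately show ?thesis using zero_le_power2[of "norm (c *\<^sub>C T h)"] by linarith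
  qed
  show ?thesis
  proof (rule ccontr)
    assume "?w \<noteq> 0"
    then have w: "(cmod ?w)\<^sup>2 > 0" by simp
    let ?\<epsilon> = "1 / (K + 1)"
    have "2 * ?\<epsilon> \<le> ?\<epsilon>\<^sup>2 * K"
    proof (rule mult_right_le_imp_le[OF _ w])
      show "2 * ?\<epsilon> * (cmod ?w)\<^sup>2 \<le> ?\<epsilon>\<^sup>2 * K * (cmod ?w)\<^sup>2"
        using ineq[of ?\<epsilon>] by (simp only: ac_simps)
    qed
    also have "\<dots> \<le> ?\<epsilon>\<^sup>2 * (K + 1)" by (intro mult_left_mono) auto
    also have "\<dots> = ?\<epsilon>" using K by (simp add: power2_eq_square)
    finally show False using K by (simp add: field_simps)
  qed
qed (simp add: clinear_0[OF T_clinear])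

lemma T_e_orthogonal: "i \<noteq> j \<Longrightarrow> cinner (T (e i)) (T (e j)) = 0"
proof (induction i j rule: linorder_wlog)
  case (le i j)
  then show ?case by (intro T_e_orthogonal_T) (simp add: orthogonal)
next
  case (sym i j)
  then show ?case using cinner_eq_0_commute by metis
qed

text \<open>
  This says that \<open>e n\<close> is an eigenvector of the adjoint times \<open>T\<close>, in a form that does not
  mention the adjoint. Only the component of \<open>x\<close> along \<open>e n\<close> contributes: the earlier ones have
  orthogonal images, and the remainder is covered by the first-order condition.
\<close>

lemma cinner_T_e: "cinner (T (e n)) (T x) = of_real ((s n)\<^sup>2) * cinner (e n) x"
proof -
  have x: "x = partial_expansion (Suc n) x + (x - partial_expansion (Suc n) x)" by simp
  have "cinner (T (e n)) (T (x - partial_expansion (Suc n) x)) = 0"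
    by (rule T_e_orthogonal_T) (simp add: remainder_orthogonal)
  then have "cinner (T (e n)) (T x) = cinner (T (e n)) (T (partial_expansion (Suc n) x))"
    by (subst x) (simp only: clinear_add[OF T_clinear] cinner_add_right add_0_right)
  also have "\<dots> = (\<Sum>i<Suc n. cnj (cinner x (e i)) * cinner (T (e n)) (T (e i)))"
    unfolding partial_expansion_def
    by (simp only: clinear_sum[OF T_clinear] clinear_scaleC[OF T_clinear] cinner_sum_right cinner_scaleC_right)
  also have "\<dots> = cnj (cinner x (e n)) * cinner (T (e n)) (T (e n))"
    by (simp add: T_e_orthogonal)
  also have "\<dots> = of_real ((s n)\<^sup>2) * cinner (e n) x"
    by (simp add: cinner_self s_def cinner_commute[of "e n" x])
  finally show ?thesis .
qed

text \<open>
  Orthogonal vectors \<open>T (e n)\<close> with norms bounded below would have no convergent subsequence.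
\<close>

lemma s_tendsto_0: "s \<longlonglongrightarrow> 0"
proof -
  obtain L where L: "s \<longlonglongrightarrow> L" "\<And>n. L \<le> s n"
    using decseq_convergent[OF decseq_s] s_nonneg by blast
  have "L = 0"
  proof (rule ccontr)
    assume "L \<noteq> 0"
    then have "L > 0" using LIMSEQ_le_const[OF L(1)] s_nonneg by force
    then have "s n \<noteq> 0" for n using L(2)[of n] by linarith
    then have "norm (e n) = 1" for n using unit_or_0[of n] by (simp add: s_eq_0_iff)
    then have "\<forall>n. T (e n) \<in> closure (T ` cball 0 1)"
      by (auto intro!: closure_subset[THEN subsetD] imageI)
    then obtain y r where r: "strict_mono (r :: nat \<Rightarrow> nat)" "((\<lambda>n. T (e n)) \<circ> r) \<longlonglongrightarrow> y"
      using T_compact unfolding compact_operator_def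
      by (meson compact_imp_seq_compact seq_compactE)
    then obtain M where M: "\<And>m n. m \<ge> M \<Longrightarrow> n \<ge> M \<Longrightarrow> dist (T (e (r m))) (T (e (r n))) < L"
      using metric_CauchyD[OF LIMSEQ_imp_Cauchy[OF r(2)] \<open>L > 0\<close>] by auto
    have "r M \<noteq> r (Suc M)" using strict_monoD[OF r(1), of M "Suc M"] by simp
    then have "cinner (T (e (r M))) (- T (e (r (Suc M)))) = 0"
      using T_e_orthogonal[of "r M" "r (Suc M)"]
        cinner_diff_right[of "T (e (r M))" 0 "T (e (r (Suc M)))"] by simp
    from norm_add_orthogonal[OF this]
    have "(s (r M))\<^sup>2 \<le> (dist (T (e (r M))) (T (e (r (Suc M)))))\<^sup>2" by (simp add: dist_norm s_def)
    then have "s (r M) \<le> dist (T (e (r M))) (T (e (r (Suc M))))"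
      by (rule power2_le_imp_le) simp
    with M[of M "Suc M"] L(2)[of "r M"] show False by simp
  qed
  with L show ?thesis by simp
qed

text \<open>
  Any operator that is dominated by \<open>T\<close> in norm is determined by its values on the vectors
  \<open>e n\<close>, since \<open>T\<close> and hence \<open>Q\<close> maps the remainders to vectors that tend to \<open>0\<close>. This is
  applied to \<open>T\<close> itself and to square roots of the adjoint times \<open>T\<close>.
\<close>

lemma dominated_expansion:
  assumes Q: "clinear Q" and le: "\<And>x. norm (Q x) \<le> norm (T x)"
  shows "(\<lambda>n. \<Sum>i<n. cinner x (e i) *\<^sub>C Q (e i)) \<longlonglongrightarrow> Q x"
proof -
  have "(\<lambda>n. Q x - (\<Sum>i<n. cinner x (e i) *\<^sub>C Q (e i))) \<longlonglongrightarrow> 0"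
  proof (rule Lim_null_comparison)
    show "eventually (\<lambda>n. norm (Q x - (\<Sum>i<n. cinner x (e i) *\<^sub>C Q (e i))) \<le> s n * norm x) sequentially"
    proof (rule always_eventually, rule allI)
      fix n
      have "Q x - (\<Sum>i<n. cinner x (e i) *\<^sub>C Q (e i)) = Q (x - partial_expansion n x)"
        by (simp add: clinear_diff[OF Q] clinear_sum[OF Q] clinear_scaleC[OF Q] partial_expansion_def)
      with le norm_T_remainder_le show "norm (Q x - (\<Sum>i<n. cinner x (e i) *\<^sub>C Q (e i))) \<le> s n * norm x"
        by (metis order_trans)
    qed
    show "(\<lambda>n. s n * norm x) \<longlonglongrightarrow> 0"
      using tendsto_mult_left_zero[OF s_tendsto_0] .
  qed
  from tendsto_diff[OF tendsto_const[of "Q x"] this] show ?thesis by simp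
qed

end

section \<open>Adjoint, absolute value and singular values\<close>

context schmidt_system
begin

lemma norm_sum_e_le:
  assumes "finite I"
  shows "(norm (\<Sum>i\<in>I. c i *\<^sub>C e i))\<^sup>2 \<le> (\<Sum>i\<in>I. (cmod (c i))\<^sup>2)"
  using assms
proof (induction I rule: finite_induct)
  case (insert k I)
  have "cinner (c k *\<^sub>C e k) (\<Sum>i\<in>I. c i *\<^sub>C e i) = 0"
    using insert.hyps by (auto simp: cinner_sum_right cinner_scaleC_left cinner_scaleC_right
        intro!: sum.neutral orthogonal)
  then have "(norm (\<Sum>i\<in>insert k I. c i *\<^sub>C e i))\<^sup>2 =
      (cmod (c k) * norm (e k))\<^sup>2 + (norm (\<Sum>i\<in>I. c i *\<^sub>C e i))\<^sup>2"
    using insert.hyps by (simp add: norm_add_orthogonal norm_scaleC)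
  also have "(cmod (c k) * norm (e k))\<^sup>2 \<le> (cmod (c k))\<^sup>2"
    using unit_or_0[of k] by auto
  finally show ?case using insert by simp
qed simp

lemma summable_e:
  assumes "summable (\<lambda>i. (cmod (c i))\<^sup>2)"
  shows "summable (\<lambda>i. c i *\<^sub>C e i)"
  unfolding summable_Cauchy
proof (intro allI impI)
  fix \<epsilon> :: real assume \<epsilon>: "\<epsilon> > 0"
  then obtain N where N: "\<And>m n. m \<ge> N \<Longrightarrow> norm (\<Sum>i = m..<n. (cmod (c i))\<^sup>2) < \<epsilon>\<^sup>2"
    using assms unfolding summable_Cauchy by (meson zero_less_power)
  have "norm (\<Sum>i = m..<n. c i *\<^sub>C e i) < \<epsilon>" if "m \<ge> N" for m n
  proof (rule power_less_imp_less_base)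
    have "(norm (\<Sum>i = m..<n. c i *\<^sub>C e i))\<^sup>2 \<le> (\<Sum>i = m..<n. (cmod (c i))\<^sup>2)"
      by (rule norm_sum_e_le) simp
    also have "\<dots> < \<epsilon>\<^sup>2" using N[OF that, of n] by simp
    finally show "(norm (\<Sum>i = m..<n. c i *\<^sub>C e i))\<^sup>2 < \<epsilon>\<^sup>2" .
  qed (use \<epsilon> in simp)
  then show "\<exists>N. \<forall>m\<ge>N. \<forall>n. norm (\<Sum>i = m..<n. c i *\<^sub>C e i) < \<epsilon>" by blast
qed

text \<open>
  Testing the bounded operator \<open>T\<close> on the partial sums of \<open>\<Sum>i. cinner y (T (e i)) *\<^sub>C e i\<close>
  shows that the coefficients are square summable; the sum is the value of the adjoint at \<open>y\<close>.
\<close>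

lemma summable_adjoint_coefficients:
  "summable (\<lambda>i. (cmod (cinner y (T (e i))))\<^sup>2)"
proof (rule summableI_nonneg_bounded)
  show "(\<Sum>i<n. (cmod (cinner y (T (e i))))\<^sup>2) \<le> (s 0 * norm y)\<^sup>2" for n
  proof -
    define v where "v = (\<Sum>i<n. cinner y (T (e i)) *\<^sub>C e i)"
    define B where "B = (\<Sum>i<n. (cmod (cinner y (T (e i))))\<^sup>2)"
    have B: "B \<ge> 0" unfolding B_def by (intro sum_nonneg) simp
    have "cinner (T v) y = (\<Sum>i<n. cinner y (T (e i)) * cnj (cinner y (T (e i))))"
      unfolding v_def clinear_sum[OF T_clinear] clinear_scaleC[OF T_clinear] cinner_sum_left cinner_scaleC_left
      by (simp add: cinner_commute[of _ y])
    also have "\<dots> = of_real B" unfolding B_def by (simp add: complex_norm_square[symmetric])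
    finally have "B = cmod (cinner (T v) y)" using B by simp
    also have "\<dots> \<le> norm (T v) * norm y" by (rule cmod_cinner_le)
    also have "\<dots> \<le> s 0 * norm v * norm y" by (intro mult_right_mono norm_T_le) simp
    finally have "B \<le> (s 0 * norm y) * norm v" by (simp add: algebra_simps)
    then have "B\<^sup>2 \<le> (s 0 * norm y)\<^sup>2 * (norm v)\<^sup>2"
      using B by (metis power_mono power_mult_distrib)
    also have "\<dots> \<le> (s 0 * norm y)\<^sup>2 * B"
      unfolding v_def B_def by (intro mult_left_mono norm_sum_e_le) simp_all
    finally have "B * B \<le> (s 0 * norm y)\<^sup>2 * B" by (simp add: power2_eq_square)
    then have "B \<le> (s 0 * norm y)\<^sup>2"
      using B by (cases "B = 0") (auto simp: mult_le_cancel_right)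
    then show ?thesis by (simp add: B_def)
  qed
qed simp

lemma bessel: "(\<Sum>i<n. (cmod (cinner x (e i)))\<^sup>2) \<le> (norm x)\<^sup>2"
proof -
  define v where "v = partial_expansion n x"
  have v_cinner: "cinner v u = (\<Sum>i<n. cinner x (e i) * cinner (e i) u)" for u
    by (simp add: v_def partial_expansion_def cinner_sum_left cinner_scaleC_left)
  have "cinner (e i) v = cnj (cinner x (e i))" if "i < n" for i
    using partial_expansion_cinner[OF that, of x] by (subst cinner_commute) (simp add: v_def)
  then have "cinner v v = (\<Sum>i<n. cinner x (e i) * cnj (cinner x (e i)))"
    by (simp add: v_cinner)
  also have "\<dots> = of_real (\<Sum>i<n. (cmod (cinner x (e i)))\<^sup>2)"
    by (simp add: complex_norm_square[symmetric])
  finally have v: "(norm v)\<^sup>2 = (\<Sum>i<n. (cmod (cinner x (e i)))\<^sup>2)"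
    by (simp only: cinner_self of_real_eq_iff)
  have "cinner (e i) (x - v) = 0" if "i < n" for i
    using remainder_orthogonal[OF that, of x] cinner_eq_0_commute unfolding v_def by blast
  then have "cinner v (x - v) = 0" by (simp add: v_cinner)
  then have "cinner (x - v) v = 0" using cinner_eq_0_commute by blast
  from norm_add_orthogonal[OF this] show ?thesis unfolding v by simp
qed

lemma bessel_summable: "summable (\<lambda>i. (cmod (cinner x (e i)))\<^sup>2)"
  by (rule summableI_nonneg_bounded[OF _ bessel]) simp

lemma hilbert_adjoint_cinner: "cinner (T x) y = cinner x (hilbert_adjoint T y)"
proof -
  define S where "S y = (\<Sum>i. cinner y (T (e i)) *\<^sub>C e i)" for y
  have S: "cinner (T x) y = cinner x (S y)" for x y
  proof -
    have "(\<lambda>n. \<Sum>i<n. cinner y (T (e i)) *\<^sub>C e i) \<longlonglongrightarrow> S y"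
      unfolding S_def by (rule summable_LIMSEQ[OF summable_e[OF summable_adjoint_coefficients]])
    from tendsto_cinner_right[OF this, of x]
    have "(\<lambda>n. \<Sum>i<n. cinner x (e i) * cinner (T (e i)) y) \<longlonglongrightarrow> cinner x (S y)"
      by (simp add: cinner_sum_right cinner_scaleC_right cinner_commute[of _ y] mult.commute)
    moreover from tendsto_cinner_left[OF dominated_expansion[OF T_clinear, of x], of y]
    have "(\<lambda>n. \<Sum>i<n. cinner x (e i) * cinner (T (e i)) y) \<longlonglongrightarrow> cinner (T x) y"
      by (simp add: cinner_sum_left cinner_scaleC_left)
    ultimately show ?thesis using LIMSEQ_unique by blast
  qed
  have "hilbert_adjoint T = S"
    unfolding hilbert_adjoint_def
  proof (rule the_equality)
    fix S' assume S': "\<forall>x y. cinner (T x) y = cinner x (S' y)"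
    show "S' = S"
    proof (rule ext, rule eq_if_cinner_left_eq)
      show "cinner x (S' y) = cinner x (S y)" for x y by (simp add: S[symmetric] S')
    qed
  qed (use S in blast)
  with S show ?thesis by simp
qed

lemma adjoint_T_cinner: "cinner ((hilbert_adjoint T \<circ> T) x) y = cinner (T x) (T y)"
  using hilbert_adjoint_cinner[of y "T x"]
  by (subst (1 2) cinner_commute) simp

lemma adjoint_T_e: "(hilbert_adjoint T \<circ> T) (e i) = of_real ((s i)\<^sup>2) *\<^sub>C e i"
  by (rule eq_if_cinner_right_eq) (simp only: adjoint_T_cinner cinner_T_e cinner_scaleC_left)

text \<open>
  The next three lemmas hold for an arbitrary positive square root \<open>Q\<close> of the adjoint times \<open>T\<close>. They
  express \<open>Q\<close> through \<open>s\<close> and \<open>e\<close>, which proves uniqueness, and they are applied to the root that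
  is constructed afterwards.
\<close>

lemma square_root_norm:
  assumes "positive_operator Q" "Q \<circ> Q = hilbert_adjoint T \<circ> T"
  shows "norm (Q x) = norm (T x)"
proof -
  have "cinner (Q x) (Q x) = cinner ((Q \<circ> Q) x) x"
    using positive_operator_symmetric[OF assms(1), of "Q x" x] by simp
  also have "\<dots> = cinner (T x) (T x)" unfolding assms(2) by (rule adjoint_T_cinner)
  finally have "(norm (Q x))\<^sup>2 = (norm (T x))\<^sup>2" by (simp only: cinner_self of_real_eq_iff)
  then show ?thesis by (simp add: power2_eq_iff_nonneg)
qed

text \<open>\<open>Q + s i\<close> is injective for \<open>s i > 0\<close> and annihilates \<open>(Q - s i) (e i)\<close>.\<close>

lemma square_root_e:
  assumes Q: "positive_operator Q" "Q \<circ> Q = hilbert_adjoint T \<circ> T"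
  shows "Q (e i) = of_real (s i) *\<^sub>C e i"
proof (cases "e i = 0")
  case True
  then show ?thesis using Q(1) by (simp add: positive_operator_def clinear_0)
next
  case False
  have lin: "clinear Q" using Q(1) by (simp add: positive_operator_def)
  define y where "y = Q (e i) - of_real (s i) *\<^sub>C e i"
  have "Q (Q (e i)) = of_real ((s i)\<^sup>2) *\<^sub>C e i"
    using fun_cong[OF Q(2), of "e i"] adjoint_T_e[of i] by simp
  then have y: "Q y = (- of_real (s i)) *\<^sub>C y"
    by (simp add: y_def clinear_diff[OF lin] clinear_scaleC[OF lin] complex_vector.scale_right_diff_distrib
        power2_eq_square)
  have "y = 0"
  proof (rule ccontr)
    assume "y \<noteq> 0"
    from positive_operator_eigenvalue[OF Q(1) y this] s_pos[OF False] show False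
      by (simp add: complex_nonneg_Reals_iff)
  qed
  then show ?thesis by (simp add: y_def)
qed

lemma square_root_expansion:
  assumes "positive_operator Q" "Q \<circ> Q = hilbert_adjoint T \<circ> T"
  shows "(\<lambda>i. (of_real (s i) * cinner x (e i)) *\<^sub>C e i) sums Q x"
  using dominated_expansion[of Q x] assms square_root_norm[OF assms] square_root_e[OF assms]
  by (simp add: positive_operator_def sums_def scaleC_scaleC mult.commute)

text \<open>
  The formula forced by \<open>square_root_expansion\<close>. It turns out to be the absolute value of \<open>T\<close>.
\<close>

definition modulus :: "'a \<Rightarrow> 'a" where
  "modulus x = (\<Sum>i. (of_real (s i) * cinner x (e i)) *\<^sub>C e i)"

lemma modulus_sums: "(\<lambda>i. (of_real (s i) * cinner x (e i)) *\<^sub>C e i) sums modulus x"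
  unfolding modulus_def
proof (rule summable_sums, rule summable_e, rule summable_comparison_test')
  show "summable (\<lambda>i. (s 0)\<^sup>2 * (cmod (cinner x (e i)))\<^sup>2)"
    by (rule summable_mult[OF bessel_summable])
  show "norm ((cmod (complex_of_real (s i) * cinner x (e i)))\<^sup>2) \<le> (s 0)\<^sup>2 * (cmod (cinner x (e i)))\<^sup>2"
    for i
    using decseq_s s_nonneg[of i] unfolding decseq_def
    by (auto simp: norm_mult power_mult_distrib intro!: mult_right_mono power_mono)
qed

lemma modulus_cinner_sums:
  "(\<lambda>i. of_real (s i) * (cinner x (e i) * cinner (e i) y)) sums cinner (modulus x) y"
  using bounded_linear.sums[OF bounded_linear_cinner_left modulus_sums, of x y]
  by (simp add: cinner_scaleC_left mult.assoc)

lemma modulus_clinear: "clinear modulus"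
proof (rule clinearI)
  show "modulus (x + y) = modulus x + modulus y" for x y
    using sums_unique2[OF modulus_sums[of "x + y"]] sums_add[OF modulus_sums[of x] modulus_sums[of y]]
    by (simp add: cinner_add_left distrib_left scaleC_add_left)
  show "modulus (c *\<^sub>C x) = c *\<^sub>C modulus x" for c x
    using sums_unique2[OF modulus_sums[of "c *\<^sub>C x"]] bounded_linear.sums[OF bounded_linear_scaleC modulus_sums[of x], of c]
    by (simp add: cinner_scaleC_left scaleC_scaleC mult.left_commute)
qed

lemma cinner_modulus_e: "cinner (e i) (modulus y) = of_real (s i) * cinner (e i) y"
proof -
  have "(\<lambda>j. of_real (s j) * (cinner y (e j) * cinner (e j) (e i))) sums
      (of_real (s i) * (cinner y (e i) * cinner (e i) (e i)))"
    using sums_single[of i "\<lambda>j. of_real (s j) * (cinner y (e j) * cinner (e j) (e i))"]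
    by (rule back_subst[of "\<lambda>f. f sums _"]) (auto simp: orthogonal)
  from sums_unique2[OF modulus_cinner_sums this]
  have "cinner (modulus y) (e i) = of_real (s i) * cinner y (e i)"
    using unit_or_0[of i] norm_eq_1_iff_cinner[of "e i"] by auto
  then show ?thesis by (subst (1 2) cinner_commute) simp
qed

lemma norm_modulus_le: "norm (modulus x) \<le> s 0 * norm x"
proof (rule LIMSEQ_le_const2)
  show "(\<lambda>n. norm (\<Sum>i<n. (of_real (s i) * cinner x (e i)) *\<^sub>C e i)) \<longlonglongrightarrow> norm (modulus x)"
    using modulus_sums[of x] by (intro tendsto_norm) (simp add: sums_def)
  have "norm (\<Sum>i<n. (of_real (s i) * cinner x (e i)) *\<^sub>C e i) \<le> s 0 * norm x" for n
  proof (rule power2_le_imp_le)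
    have "(norm (\<Sum>i<n. (of_real (s i) * cinner x (e i)) *\<^sub>C e i))\<^sup>2 \<le>
        (\<Sum>i<n. (cmod (of_real (s i) * cinner x (e i)))\<^sup>2)"
      by (rule norm_sum_e_le) simp
    also have "\<dots> \<le> (\<Sum>i<n. (s 0)\<^sup>2 * (cmod (cinner x (e i)))\<^sup>2)"
      using decseq_s s_nonneg unfolding decseq_def
      by (intro sum_mono) (auto simp: norm_mult power_mult_distrib intro!: mult_right_mono power_mono)
    also have "\<dots> \<le> (s 0)\<^sup>2 * (norm x)\<^sup>2"
      unfolding sum_distrib_left[symmetric] by (intro mult_left_mono bessel) simp
    finally show "(norm (\<Sum>i<n. (of_real (s i) * cinner x (e i)) *\<^sub>C e i))\<^sup>2 \<le> (s 0 * norm x)\<^sup>2"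
      by (simp add: power_mult_distrib)
  qed (use s_nonneg in simp)
  then show "\<exists>N. \<forall>n\<ge>N. norm (\<Sum>i<n. (of_real (s i) * cinner x (e i)) *\<^sub>C e i) \<le> s 0 * norm x"
    by blast
qed

lemma modulus_positive: "positive_operator modulus"
  unfolding positive_operator_def
proof (intro conjI allI)
  show "clinear modulus" by (rule modulus_clinear)
  show "bounded_linear modulus" by (rule clinear_imp_bounded_linear[OF modulus_clinear norm_modulus_le])
  fix x
  have closed: "closed (\<real>\<^sub>\<ge>\<^sub>0 :: complex set)" by simp
  have "of_real (s i) * (cinner x (e i) * cinner (e i) x) \<in> \<real>\<^sub>\<ge>\<^sub>0" for i
  proof -
    have "of_real (s i) * (cinner x (e i) * cinner (e i) x) = of_real (s i * (cmod (cinner x (e i)))\<^sup>2)"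
      by (subst (2) cinner_commute) (simp add: complex_norm_square[symmetric])
    also have "\<dots> \<in> \<real>\<^sub>\<ge>\<^sub>0" by (simp only: nonneg_Reals_of_real_iff) (simp add: s_nonneg)
    finally show ?thesis .
  qed
  then have "(\<Sum>i<n. of_real (s i) * (cinner x (e i) * cinner (e i) x)) \<in> \<real>\<^sub>\<ge>\<^sub>0" for n
    by (induction n) simp_all
  then show "cinner (modulus x) x \<in> \<real>\<^sub>\<ge>\<^sub>0"
    using modulus_cinner_sums[of x x] closed
    by (intro Lim_in_closed_set[OF closed _ sequentially_bot]) (auto simp: sums_def)
qed

text \<open>
  Both sides have the matrix elements \<open>\<Sum>i. (s i)\<^sup>2 * (cinner x (e i) * cinner (e i) y)\<close>.
\<close>

lemma modulus_square: "modulus \<circ> modulus = hilbert_adjoint T \<circ> T"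
proof (rule ext, rule eq_if_cinner_right_eq)
  fix x y
  let ?f = "\<lambda>i. of_real ((s i)\<^sup>2) * (cinner x (e i) * cinner (e i) y)"
  have "cinner ((modulus \<circ> modulus) x) y = cinner (modulus x) (modulus y)"
    using positive_operator_symmetric[OF modulus_positive, of "modulus x" y] by simp
  moreover have f1: "?f sums cinner (modulus x) (modulus y)"
    using modulus_cinner_sums[of x "modulus y"] by (simp add: cinner_modulus_e power2_eq_square ac_simps)
  moreover have f2: "?f sums cinner (T x) (T y)"
    using tendsto_cinner_left[OF dominated_expansion[OF T_clinear, of x], of "T y"]
    by (simp add: sums_def cinner_sum_left cinner_scaleC_left cinner_T_e ac_simps)
  ultimately show "cinner ((modulus \<circ> modulus) x) y = cinner ((hilbert_adjoint T \<circ> T) x) y"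
    unfolding adjoint_T_cinner using sums_unique2[OF f1 f2] by simp
qed

lemma abs_operator_eq_modulus: "abs_operator T = modulus"
  unfolding abs_operator_def sqrt_operator_def
proof (rule the_equality)
  show "positive_operator modulus \<and> modulus \<circ> modulus = hilbert_adjoint T \<circ> T"
    using modulus_positive modulus_square by blast
  fix Q assume "positive_operator Q \<and> Q \<circ> Q = hilbert_adjoint T \<circ> T"
  then show "Q = modulus"
    using sums_unique2[OF square_root_expansion modulus_sums] by blast
qed

text \<open>
  By symmetry an eigenvector for \<open>z\<close> is orthogonal to every \<open>e i\<close> with \<open>s i \<noteq> z\<close>; the
  expansion of \<open>modulus x = z *\<^sub>C x\<close> then involves only the remaining vectors.
\<close>

lemma modulus_eigenvector:
  assumes x: "modulus x = z *\<^sub>C x" and z: "z \<noteq> 0"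
  shows "x \<in> cspan (e ` {i. of_real (s i) = z})"
proof -
  let ?J = "{i. complex_of_real (s i) = z}"
  have zero: "cinner x (e i) = 0" if "i \<notin> ?J" for i
  proof -
    have "z * cinner x (e i) = cinner (modulus x) (e i)" by (simp add: x cinner_scaleC_left)
    also have "\<dots> = cinner x (modulus (e i))"
      by (rule positive_operator_symmetric[OF modulus_positive])
    also have "\<dots> = of_real (s i) * cinner x (e i)"
      by (simp add: square_root_e[OF modulus_positive modulus_square] cinner_scaleC_right)
    finally show ?thesis using that by auto
  qed
  have "finite ?J"
  proof -
    have "eventually (\<lambda>i. s i < cmod z) sequentially"
      using order_tendstoD(2)[OF s_tendsto_0, of "cmod z"] z by simp
    then obtain n where "\<And>i. i \<ge> n \<Longrightarrow> s i < cmod z" by (auto simp: eventually_sequentially)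
    then have n: "n \<le> i \<Longrightarrow> s i < cmod z" for i by blast
    have "?J \<subseteq> {..<n}"
    proof
      fix i assume "i \<in> ?J"
      then have "cmod z = s i" using s_nonneg by auto
      then show "i \<in> {..<n}" using n[of i] by (cases "n \<le> i") auto
    qed
    then show ?thesis using finite_subset by blast
  qed
  then have "(\<lambda>i. (of_real (s i) * cinner x (e i)) *\<^sub>C e i) sums
      (\<Sum>i\<in>?J. (of_real (s i) * cinner x (e i)) *\<^sub>C e i)"
    by (rule sums_finite) (simp add: zero)
  from sums_unique2[OF modulus_sums this]
  have "modulus x \<in> cspan (e ` ?J)"
    by (simp only:) (intro complex_vector.span_sum complex_vector.span_scale complex_vector.span_base imageI)
  then have "inverse z *\<^sub>C modulus x \<in> cspan (e ` ?J)" by (rule complex_vector.span_scale)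
  then show ?thesis using z by (simp add: x)
qed

text \<open>
  A positive operator has no generalised eigenvectors besides its eigenvectors: its eigenvalues are
  real, so the operator minus an eigenvalue is symmetric, and a symmetric operator whose square
  annihilates a vector annihilates the vector itself.
\<close>

lemma modulus_algebraic_multiplicity:
  assumes z: "z \<noteq> 0"
  shows "algebraic_multiplicity modulus z = card {i. complex_of_real (s i) = z}"
proof -
  let ?J = "{i. complex_of_real (s i) = z}"
  let ?D = "\<lambda>y. modulus y - z *\<^sub>C y"
  have D2: "?D x = 0" if "?D (?D x) = 0" for x
  proof (rule ccontr)
    assume nz: "?D x \<noteq> 0"
    have "modulus (?D x) = z *\<^sub>C ?D x" using that by simp
    from positive_operator_eigenvalue[OF modulus_positive this nz] have real: "cnj z = z"
      by (auto simp: complex_nonneg_Reals_iff complex_eq_iff)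
    have "cinner (?D x) (?D x) = cinner x (?D (?D x))"
      using positive_operator_symmetric[OF modulus_positive, of x "?D x"]
      by (simp only: cinner_diff_left cinner_diff_right[of x "modulus (?D x)"] cinner_scaleC_left
          cinner_scaleC_right real)
    with that nz show False by simp
  qed
  have "?D x = 0" if "(?D ^^ n) x = 0" for n x
    using that
  proof (induction n arbitrary: x)
    case 0
    then show ?case by (simp add: clinear_0[OF modulus_clinear])
  next
    case (Suc n)
    then have "(?D ^^ n) (?D x) = 0" by (simp add: funpow_Suc_right del: funpow.simps)
    then show ?case by (rule D2[OF Suc.IH])
  qed
  then have "modulus x = z *\<^sub>C x" if "(?D ^^ n) x = 0" for n x using that by fastforce
  then have "x \<in> cspan (e ` ?J)" if "(?D ^^ n) x = 0" for n x
    using that by (intro modulus_eigenvector[OF _ z])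
  then have "(\<Union>n. {x. (?D ^^ n) x = 0}) \<subseteq> cspan (e ` ?J)" by blast
  moreover have "cspan (e ` ?J) \<subseteq> (\<Union>n. {x. (?D ^^ n) x = 0})"
  proof
    fix x assume "x \<in> cspan (e ` ?J)"
    then have "?D x = 0"
    proof (induction rule: complex_vector.span_induct_alt)
      case (step c b y)
      then obtain i where i: "b = e i" "complex_of_real (s i) = z" by auto
      have "modulus y = z *\<^sub>C y" using step by simp
      then show ?case using i
        by (simp add: clinear_add[OF modulus_clinear] clinear_scaleC[OF modulus_clinear]
            square_root_e[OF modulus_positive modulus_square] scaleC_add_right scaleC_scaleC mult.commute)
    qed (simp add: clinear_0[OF modulus_clinear])
    then have "(?D ^^ 1) x = 0" by simp
    then show "x \<in> (\<Union>n. {x. (?D ^^ n) x = 0})" by blast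
  qed
  ultimately have space: "(\<Union>n. {x. (?D ^^ n) x = 0}) = cspan (e ` ?J)" by (rule antisym)
  have unit: "norm (e i) = 1" if "i \<in> ?J" for i
    using that z unit_or_0[of i] by (auto simp: s_eq_0_iff)
  have inj: "inj_on e ?J"
  proof (rule inj_onI, rule ccontr)
    fix i j assume ij: "i \<in> ?J" "e i = e j" "i \<noteq> j"
    then have "e i = 0" using orthogonal[of i j] by simp
    with unit[OF ij(1)] show False by simp
  qed
  have "complex_vector.independent (e ` ?J)"
    unfolding complex_vector.dependent_def
  proof
    assume "\<exists>a\<in>e ` ?J. a \<in> cspan (e ` ?J - {a})"
    then obtain k where k: "k \<in> ?J" "e k \<in> cspan (e ` ?J - {e k})" by blast
    have "cinner (e k) (e k) = 0"
      by (rule cinner_cspan_eq_0[OF _ k(2)]) (auto intro: orthogonal)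
    with unit[of k] k show False by simp
  qed
  then show ?thesis
    unfolding algebraic_multiplicity_def space
    using inj by (simp add: complex_vector.dim_eq_card_independent card_image)
qed

lemma modulus_eigenvalue_sequence: "eigenvalue_sequence modulus (\<lambda>j. of_real (s j))"
  unfolding eigenvalue_sequence_def
proof (intro conjI allI impI)
  show "(\<lambda>j. complex_of_real (s j)) \<longlonglongrightarrow> 0"
    using tendsto_of_real[OF s_tendsto_0, where 'a = complex] by simp
  show "decseq (\<lambda>j. cmod (of_real (s j)))" using decseq_s s_nonneg by simp
qed (simp add: modulus_algebraic_multiplicity)

theorem singular_value_eq: "singular_value T = s"
proof
  fix j
  define l where "l = some_eigenvalue_sequence modulus"
  have l: "eigenvalue_sequence modulus l"
    unfolding l_def some_eigenvalue_sequence_def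
    by (rule someI[where P = "eigenvalue_sequence modulus", OF modulus_eigenvalue_sequence])
  have "l j = of_real (cmod (l j))"
  proof (cases "l j = 0")
    case False
    then have "card {i. l i = l j} = card {i. complex_of_real (s i) = l j}"
      using l modulus_eigenvalue_sequence by (simp add: eigenvalue_sequence_def)
    moreover have "finite {i. l i = l j}"
      using False eigenvalue_sequence_finite[OF l, of "cmod (l j)"] by (auto elim!: finite_subset[rotated])
    moreover have "j \<in> {i. l i = l j}" by simp
    ultimately have "card {i. complex_of_real (s i) = l j} \<noteq> 0" by (metis card_0_eq emptyE)
    then have "{i. complex_of_real (s i) = l j} \<noteq> {}" by (metis card.empty)
    then obtain i where "complex_of_real (s i) = l j" by blast
    then show ?thesis using s_nonneg[of i] by (metis norm_of_real abs_of_nonneg)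
  qed simp
  moreover have "cmod (l j) = s j"
    using eigenvalue_sequence_cmod_eq[OF l modulus_eigenvalue_sequence, of j] s_nonneg by simp
  ultimately show "singular_value T j = s j"
    by (metis Re_complex_of_real abs_operator_eq_modulus l_def singular_value_def)
qed

end

section \<open>Existence of the Schmidt decomposition\<close>

lemma parallelogram:
  "(norm (x + y))\<^sup>2 + (norm (x - y))\<^sup>2 = 2 * (norm x)\<^sup>2 + 2 * (norm (y::'a::real_inner))\<^sup>2"
  by (simp add: power2_norm_eq_inner inner_add_left inner_add_right inner_diff_left inner_diff_right)

text \<open>
  The norm of \<open>T\<close> on the closed subspace \<open>V\<close> is attained. For a maximising sequence compactness
  provides convergence of the images, and the parallelogram identity transfers it to the sequence
  itself.
\<close>

lemma norm_maximiser_on_complement: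
  fixes T :: "'a::complex_hilbert_space \<Rightarrow> 'a" and e :: "nat \<Rightarrow> 'a"
  assumes T: "compact_operator T"
  shows "\<exists>u. (norm u = 1 \<or> u = 0) \<and> (T u = 0 \<longrightarrow> u = 0) \<and> (\<forall>i<n. cinner u (e i) = 0) \<and>
    (\<forall>x. (\<forall>i<n. cinner x (e i) = 0) \<longrightarrow> norm (T x) \<le> norm (T u) * norm x)"
proof -
  have lin: "clinear T" using T by (simp add: compact_operator_def)
  define V where "V = {x. \<forall>i<n. cinner x (e i) = 0}"
  have V_scale: "c *\<^sub>C x \<in> V" and V_add: "x + y \<in> V" if "x \<in> V" "y \<in> V" for c x y
    using that by (auto simp: V_def cinner_scaleC_left cinner_add_left)
  obtain K where K: "\<And>x. norm (T x) \<le> K * norm x" using compact_operator_bounded[OF T] by blast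
  define R where "R = (\<lambda>x. norm (T x)) ` (V \<inter> sphere 0 1)"
  show ?thesis
  proof (cases "\<forall>x\<in>V. T x = 0")
    case True
    then show ?thesis by (intro exI[of _ 0]) (auto simp: V_def clinear_0[OF lin])
  next
    case False
    then obtain v where v: "v \<in> V" "T v \<noteq> 0" by blast
    then have v0: "v \<noteq> 0" using clinear_0[OF lin] by auto
    define w where "w = of_real (1 / norm v) *\<^sub>C v"
    have w: "w \<in> V" "norm w = 1" "T w \<noteq> 0"
      using v v0 V_scale by (auto simp: w_def norm_scaleC norm_divide clinear_scaleC[OF lin])
    have "r \<le> K" if "r \<in> R" for r using that K by (auto simp: R_def) (metis mult.right_neutral)
    then have R_bdd: "bdd_above R" by (rule bdd_aboveI)
    have R_ne: "R \<noteq> {}" using w by (auto simp: R_def)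
    define \<sigma> where "\<sigma> = Sup R"
    have \<sigma>_upper: "norm (T x) \<le> \<sigma>" if "x \<in> V" "norm x = 1" for x
      unfolding \<sigma>_def using that by (intro cSup_upper R_bdd) (auto simp: R_def)
    have \<sigma>: "\<sigma> > 0" using \<sigma>_upper[OF w(1,2)] w(3) by (smt (verit) zero_less_norm_iff)
    have \<sigma>_le: "norm (T x) \<le> \<sigma> * norm x" if "x \<in> V" for x
    proof (cases "x = 0")
      case False
      have "norm (T (of_real (1 / norm x) *\<^sub>C x)) \<le> \<sigma>"
        using False that V_scale by (intro \<sigma>_upper) (auto simp: norm_scaleC norm_divide)
      then show ?thesis using False
        by (simp add: clinear_scaleC[OF lin] norm_scaleC norm_divide field_simps)
    qed (simp add: clinear_0[OF lin])
    have "\<exists>x. x \<in> V \<and> norm x = 1 \<and> \<sigma> - inverse (real (Suc k)) < norm (T x)" for k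
      using less_cSupE[of "\<sigma> - inverse (real (Suc k))" R] R_ne unfolding \<sigma>_def R_def by force
    then obtain X where X: "\<And>k. X k \<in> V" "\<And>k. norm (X k) = 1"
      "\<And>k. \<sigma> - inverse (real (Suc k)) < norm (T (X k))" by metis
    have "(\<lambda>k. norm (T (X k))) \<longlonglongrightarrow> \<sigma>"
    proof (rule tendsto_sandwich[where h = "\<lambda>_. \<sigma>"])
      show "(\<lambda>k. \<sigma> - inverse (real (Suc k))) \<longlonglongrightarrow> \<sigma>"
        using tendsto_diff[OF tendsto_const LIMSEQ_inverse_real_of_nat] by simp
      show "eventually (\<lambda>k. \<sigma> - inverse (real (Suc k)) \<le> norm (T (X k))) sequentially"
        using X(3) less_imp_le by (intro always_eventually) blast
      show "eventually (\<lambda>k. norm (T (X k)) \<le> \<sigma>) sequentially"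
        using X \<sigma>_upper by (intro always_eventually) blast
    qed simp
    moreover have "\<forall>k. T (X k) \<in> closure (T ` cball 0 1)"
      using X(2) by (auto intro!: closure_subset[THEN subsetD] imageI)
    then obtain y r where r: "strict_mono r" "((\<lambda>k. T (X k)) \<circ> r) \<longlonglongrightarrow> y"
      using T unfolding compact_operator_def
      by (meson compact_imp_seq_compact seq_compactE)
    ultimately have norm_y: "norm y = \<sigma>"
      using LIMSEQ_unique[OF tendsto_norm[OF r(2)]] LIMSEQ_subseq_LIMSEQ r(1) by (force simp: o_def)
    define Z where "Z k = X (r k)" for k
    have Z: "Z k \<in> V" "norm (Z k) = 1" for k using X by (auto simp: Z_def)
    have TZ: "(\<lambda>k. T (Z k)) \<longlonglongrightarrow> y" using r(2) by (simp add: Z_def o_def)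
    \<comment> \<open>If \<open>T (Z j)\<close> and \<open>T (Z k)\<close> are both close to \<open>y\<close>, then \<open>norm (Z j + Z k)\<close> is close to \<open>2\<close>,
      and the parallelogram identity makes \<open>Z j - Z k\<close> small.\<close>
    have close: "(norm (Z j - Z k))\<^sup>2 \<le> 8 * \<delta> / \<sigma>"
      if \<delta>: "\<delta> > 0" "norm (T (Z j) - y) \<le> \<delta>" "norm (T (Z k) - y) \<le> \<delta>" for j k \<delta>
    proof -
      have "2 * \<sigma> = norm (2 *\<^sub>R y)" by (simp add: norm_y)
      also have "2 *\<^sub>R y = T (Z j + Z k) - (T (Z j) - y) - (T (Z k) - y)"
        by (simp add: clinear_add[OF lin] scaleR_2)
      also have "norm \<dots> \<le> norm (T (Z j + Z k)) + \<delta> + \<delta>"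
        using \<delta> by (smt (verit) norm_triangle_ineq4)
      also have "\<dots> \<le> \<sigma> * norm (Z j + Z k) + 2 * \<delta>" using \<sigma>_le[OF V_add[OF Z(1) Z(1)], of j k] by simp
      finally have "2 - 2 * \<delta> / \<sigma> \<le> norm (Z j + Z k)" using \<sigma> by (simp add: field_simps)
      moreover have "norm (Z j + Z k) \<le> 2" using norm_triangle_ineq[of "Z j" "Z k"] Z by simp
      ultimately have "4 - (norm (Z j + Z k))\<^sup>2 \<le> 4 * (2 * \<delta> / \<sigma>)"
        using mult_mono[of "2 - norm (Z j + Z k)" "2 * \<delta> / \<sigma>" "2 + norm (Z j + Z k)" 4] \<delta> \<sigma>
        by (simp add: power2_eq_square algebra_simps)
      then show ?thesis using parallelogram[of "Z j" "Z k"] Z by simp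
    qed
    have "Cauchy Z"
    proof (rule metric_CauchyI)
      fix \<epsilon> :: real assume \<epsilon>: "\<epsilon> > 0"
      define \<delta> where "\<delta> = \<epsilon>\<^sup>2 * \<sigma> / 16"
      have \<delta>: "\<delta> > 0" using \<epsilon> \<sigma> by (simp add: \<delta>_def)
      then obtain M where M: "\<And>k. k \<ge> M \<Longrightarrow> norm (T (Z k) - y) < \<delta>"
        using TZ unfolding lim_sequentially dist_norm by blast
      have "dist (Z j) (Z k) < \<epsilon>" if "j \<ge> M" "k \<ge> M" for j k
      proof (rule power_less_imp_less_base)
        have "(dist (Z j) (Z k))\<^sup>2 \<le> 8 * \<delta> / \<sigma>"
          unfolding dist_norm using M[OF that(1)] M[OF that(2)] \<delta> by (intro close) auto
        also have "\<dots> < \<epsilon>\<^sup>2" using \<epsilon> \<sigma> by (simp add: \<delta>_def)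
        finally show "(dist (Z j) (Z k))\<^sup>2 < \<epsilon>\<^sup>2" .
      qed (use \<epsilon> in simp)
      then show "\<exists>M. \<forall>j\<ge>M. \<forall>k\<ge>M. dist (Z j) (Z k) < \<epsilon>" by blast
    qed
    then obtain u where u: "Z \<longlonglongrightarrow> u" using Cauchy_convergent convergent_def by blast
    have "(\<lambda>k. T (Z k)) \<longlonglongrightarrow> T u"
      using bounded_linear.tendsto[OF clinear_imp_bounded_linear[OF lin K] u] .
    then have Tu: "T u = y" using TZ LIMSEQ_unique by blast
    have "norm u = 1" using LIMSEQ_unique[OF tendsto_norm[OF u]] Z by simp
    moreover have "cinner u (e i) = 0" if "i < n" for i
      using LIMSEQ_unique[OF tendsto_cinner_left[OF u, of "e i"]] Z(1) that by (simp add: V_def)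
    ultimately show ?thesis
      using \<sigma>_le norm_y \<sigma> by (intro exI[of _ u]) (auto simp: Tu V_def)
  qed
qed

theorem schmidt_system_exists:
  fixes T :: "'a::complex_hilbert_space \<Rightarrow> 'a"
  assumes T: "compact_operator T"
  shows "\<exists>e. schmidt_system T e"
proof -
  define Q where "Q e n u \<longleftrightarrow> (norm u = 1 \<or> u = 0) \<and> (T u = 0 \<longrightarrow> u = 0) \<and> (\<forall>i<n. cinner u (e i) = 0) \<and>
    (\<forall>x. (\<forall>i<n. cinner x (e i) = 0) \<longrightarrow> norm (T x) \<le> norm (T u) * norm x)" for e :: "nat \<Rightarrow> 'a" and n u
  have "\<exists>e. \<forall>n. Q e n (e n)"
  proof (rule dependent_wellorder_choice[of Q])
    show "Q f n u = Q g n u" if "\<And>i. i < n \<Longrightarrow> f i = g i" for f g n u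
      using that by (simp add: Q_def)
    show "\<exists>u. Q f n u" for f n
      using norm_maximiser_on_complement[OF T, of n f] by (simp only: Q_def)
  qed
  then obtain e where e: "\<And>n. Q e n (e n)" by blast
  note e = e[unfolded Q_def]
  show ?thesis
  proof (intro exI[of _ e] schmidt_system.intro T)
    show "cinner (e n) (e i) = 0" if "i < n" for n i using e[of n] that by blast
  qed (use e in blast)+
qed

section \<open>Triangular form on spans of generalised eigenvectors\<close>

definition generalised_eigenspace :: "('a::complex_hilbert_space \<Rightarrow> 'a) \<Rightarrow> complex \<Rightarrow> 'a set" where
  "generalised_eigenspace T z = (\<Union>n. {x. ((\<lambda>y. T y - z *\<^sub>C y) ^^ n) x = 0})"

text \<open>
  An orthonormal basis in which the restriction of \<open>T\<close> to an invariant subspace is upper triangular with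
  diagonal \<open>l\<close>.
\<close>

definition schur_basis ::
    "('a::complex_hilbert_space \<Rightarrow> 'a) \<Rightarrow> (nat \<Rightarrow> complex) \<Rightarrow> nat \<Rightarrow> (nat \<Rightarrow> 'a) \<Rightarrow> bool" where
  "schur_basis T l N f \<longleftrightarrow> orthonormal_upto N f \<and>
     (\<forall>k<N. T (f k) - l k *\<^sub>C f k \<in> cspan (f ` {..<k}))"

lemma schur_basis_invariant:
  assumes "clinear T" "schur_basis T l N f" "x \<in> cspan (f ` {..<N})"
  shows "T x \<in> cspan (f ` {..<N})"
  using assms(3)
proof (induction rule: complex_vector.span_induct_alt)
  case (step c b y)
  then obtain k where k: "k < N" "b = f k" by auto
  have "T b - l k *\<^sub>C b \<in> cspan (f ` {..<N})"
    using assms(2) k complex_vector.span_mono[of "f ` {..<k}" "f ` {..<N}"]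
    by (fastforce simp: schur_basis_def)
  moreover have "l k *\<^sub>C b \<in> cspan (f ` {..<N})"
    using step by (intro complex_vector.span_scale complex_vector.span_base)
  ultimately have "T b \<in> cspan (f ` {..<N})"
    using complex_vector.span_add[of "T b - l k *\<^sub>C b" _ "l k *\<^sub>C b"] by simp
  with step show ?case
    by (simp add: clinear_add[OF assms(1)] clinear_scaleC[OF assms(1)]
        complex_vector.span_add complex_vector.span_scale)
qed (simp add: clinear_0[OF assms(1)] complex_vector.span_zero)

lemma schur_basis_mono: "schur_basis T l N f \<Longrightarrow> M \<le> N \<Longrightarrow> schur_basis T l M f"
  by (auto simp: schur_basis_def orthonormal_upto_def)

text \<open>
  In triangular form, a generalised eigenspace has at most as many dimensions as its eigenvalue has
  entries on the diagonal: the intersections with the spans of \<open>f 0, \<dots>, f (N - 1)\<close> grow by at most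
  one dimension per step, and only at steps with \<open>l N = z\<close>. The bound on the dimension is stated by
  a spanning set, since \<open>complex_vector.dim\<close> is not monotone where infinite dimensions occur.
\<close>

lemma generalised_eigenspace_schur:
  assumes T: "clinear T" and f: "schur_basis T l N f"
  shows "\<exists>B. finite B \<and> card B \<le> card {j. j < N \<and> l j = z} \<and>
    generalised_eigenspace T z \<inter> cspan (f ` {..<N}) \<subseteq> cspan B"
  using f
proof (induction N)
  case 0
  show ?case by (intro exI[of _ "{}"]) auto
next
  case (Suc N)
  let ?W = "cspan (f ` {..<N})" and ?W' = "cspan (f ` {..<Suc N})"
  let ?G = "generalised_eigenspace T z" and ?D = "\<lambda>y. T y - z *\<^sub>C y"
  have f: "schur_basis T l N f" using Suc.prems schur_basis_mono le_SucI order_refl by blast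
  obtain B where B: "finite B" "card B \<le> card {j. j < N \<and> l j = z}" "?G \<inter> ?W \<subseteq> cspan B"
    using Suc.IH[OF f] by blast
  show ?case
  proof (cases "l N = z")
    case False
    have W'_cases: "\<exists>c. x - c *\<^sub>C f N \<in> ?W" if "x \<in> ?W'" for x
      using that by (simp add: lessThan_Suc complex_vector.span_insert)
    have D_W: "?D y \<in> ?W" if "y \<in> ?W" for y
      using schur_basis_invariant[OF T f that] that
      by (intro complex_vector.span_diff complex_vector.span_scale)
    have fN: "?D (f N) - (l N - z) *\<^sub>C f N \<in> ?W"
      using Suc.prems by (simp add: schur_basis_def complex_vector.scale_left_diff_distrib)
    have D_iter: "(?D ^^ n) x - ((l N - z) ^ n * c) *\<^sub>C f N \<in> ?W"
      if "x - c *\<^sub>C f N \<in> ?W" for n x c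
    proof (induction n)
      case (Suc n)
      let ?x = "(?D ^^ n) x" and ?c = "(l N - z) ^ n * c"
      have "?D (?x - ?c *\<^sub>C f N) + ?c *\<^sub>C (?D (f N) - (l N - z) *\<^sub>C f N) \<in> ?W"
        by (intro complex_vector.span_add complex_vector.span_scale D_W Suc.IH fN)
      moreover have "?D (y - d *\<^sub>C u) + d *\<^sub>C (?D u - w *\<^sub>C u) = ?D y - (w * d) *\<^sub>C u" for y u d w
        by (simp add: clinear_diff[OF T] clinear_scaleC[OF T] scaleC_scaleC
            complex_vector.scale_right_diff_distrib mult.commute)
      ultimately have "?D ?x - ((l N - z) * ?c) *\<^sub>C f N \<in> ?W" by simp
      then show ?case by (simp add: mult.assoc)
    qed (use that in simp)
    have fN_notin: "f N \<notin> ?W"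
    proof
      assume "f N \<in> ?W"
      then have "cinner (f N) (f N) = 0"
        by (rule cinner_cspan_eq_0[rotated])
          (use Suc.prems in \<open>auto simp: schur_basis_def orthonormal_upto_def\<close>)
      moreover have "cinner (f N) (f N) = 1"
        using Suc.prems unfolding schur_basis_def orthonormal_upto_def by simp
      ultimately show False by simp
    qed
    have "?G \<inter> ?W' \<subseteq> ?G \<inter> ?W"
    proof
      fix x assume x: "x \<in> ?G \<inter> ?W'"
      then obtain n where n: "(?D ^^ n) x = 0" by (auto simp: generalised_eigenspace_def)
      obtain c where c: "x - c *\<^sub>C f N \<in> ?W" using W'_cases x by blast
      define k where "k = (l N - z) ^ n * c"
      have "- (k *\<^sub>C f N) \<in> ?W" using D_iter[OF c, of n] n by (simp add: k_def)
      then have "k *\<^sub>C f N \<in> ?W" using complex_vector.span_neg by fastforce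
      then have "inverse k *\<^sub>C k *\<^sub>C f N \<in> ?W" by (rule complex_vector.span_scale)
      then have "k = 0" using fN_notin by (cases "k = 0") (simp_all add: scaleC_scaleC)
      then have "c = 0" using False by (simp add: k_def)
      with c x show "x \<in> ?G \<inter> ?W" by simp
    qed
    then show ?thesis using B False
      by (intro exI[of _ B]) (auto simp: less_Suc_eq conj_disj_distribR Collect_disj_eq cong: conj_cong)
  next
    case True
    have card: "card {j. j < Suc N \<and> l j = z} = Suc (card {j. j < N \<and> l j = z})"
    proof -
      have "{j. j < Suc N \<and> l j = z} = insert N {j. j < N \<and> l j = z}" using True by auto
      then show ?thesis by simp
    qed
    show ?thesis
    proof (cases "?G \<inter> ?W' \<subseteq> ?W")
      case True
      then show ?thesis using B card by (intro exI[of _ B]) auto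
    next
      case False
      then obtain a where a: "a \<in> ?G" "a \<in> ?W'" "a \<notin> ?W" by blast
      obtain c where c: "a - c *\<^sub>C f N \<in> ?W"
        using a(2) by (auto simp: lessThan_Suc complex_vector.span_insert)
      have c0: "c \<noteq> 0" using c a(3) by auto
      have G_diff: "x - d *\<^sub>C y \<in> ?G" if xy: "x \<in> ?G" "y \<in> ?G" for x y d
      proof -
        have D_clinear: "clinear (?D ^^ n)" for n
        proof (induction n)
          case 0
          then show ?case by (intro clinearI) simp_all
        next
          case (Suc n)
          then show ?case
            by (intro clinearI) (simp_all add: clinear_add clinear_scaleC T scaleC_add_right
                complex_vector.scale_right_diff_distrib scaleC_scaleC mult.commute)
        qed
        have D0: "(?D ^^ m) u = 0" if "(?D ^^ n) u = 0" "n \<le> m" for m n u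
        proof -
          have "(?D ^^ m) u = (?D ^^ (m - n)) ((?D ^^ n) u)"
            using funpow_add[of "m - n" n ?D] that(2) by simp
          then show ?thesis using that(1) clinear_0[OF D_clinear] by simp
        qed
        obtain n m where "(?D ^^ n) x = 0" "(?D ^^ m) y = 0"
          using xy by (auto simp: generalised_eigenspace_def)
        then have "(?D ^^ max n m) x = 0" "(?D ^^ max n m) y = 0" using D0 by (meson max.cobounded1 max.cobounded2)+
        then have "(?D ^^ max n m) (x - d *\<^sub>C y) = 0"
          by (simp add: clinear_diff[OF D_clinear] clinear_scaleC[OF D_clinear])
        then show ?thesis unfolding generalised_eigenspace_def by blast
      qed
      have "?G \<inter> ?W' \<subseteq> cspan (insert a B)"
      proof
        fix x assume x: "x \<in> ?G \<inter> ?W'"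
        then obtain d where d: "x - d *\<^sub>C f N \<in> ?W"
          by (auto simp: lessThan_Suc complex_vector.span_insert)
        have "(x - d *\<^sub>C f N) - (d / c) *\<^sub>C (a - c *\<^sub>C f N) \<in> ?W"
          by (intro complex_vector.span_diff complex_vector.span_scale c d)
        moreover have "(x - d *\<^sub>C f N) - (d / c) *\<^sub>C (a - c *\<^sub>C f N) = x - (d / c) *\<^sub>C a"
          using c0 by (simp add: complex_vector.scale_right_diff_distrib scaleC_scaleC)
        ultimately have "x - (d / c) *\<^sub>C a \<in> cspan B" using G_diff x a(1) B(3) by auto
        then show "x \<in> cspan (insert a B)" by (auto simp: complex_vector.span_insert)
      qed
      then show ?thesis using B card
        by (intro exI[of _ "insert a B"]) (auto intro: order_trans[OF card_insert_le_m1] simp: card_insert_if)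
    qed
  qed
qed

text \<open>
  If no vector outside the invariant subspace \<open>W\<close> were mapped into \<open>W\<close> by \<open>T\<close> minus \<open>l N\<close>, then
  by induction on the exponent the whole generalised eigenspace would lie in \<open>W\<close>. Such a vector, made
  orthogonal to \<open>W\<close> and normalised, extends the basis.
\<close>

lemma schur_basis_extend:
  assumes T: "clinear T" and f: "schur_basis T l N f"
    and G: "\<not> generalised_eigenspace T (l N) \<subseteq> cspan (f ` {..<N})"
  shows "\<exists>g. schur_basis T l (Suc N) g"
proof -
  let ?W = "cspan (f ` {..<N})" and ?D = "\<lambda>y. T y - l N *\<^sub>C y"
  have "\<exists>v. v \<notin> ?W \<and> ?D v \<in> ?W"
  proof (rule ccontr)
    assume none: "\<not> ?thesis"
    have "x \<in> ?W" if "(?D ^^ n) x = 0" for n x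
      using that
    proof (induction n arbitrary: x)
      case (Suc n)
      then have "?D x \<in> ?W" by (simp add: funpow_Suc_right del: funpow.simps)
      with none show ?case by blast
    qed (simp add: complex_vector.span_zero)
    with G show False by (auto simp: generalised_eigenspace_def)
  qed
  then obtain v where v: "v \<notin> ?W" "?D v \<in> ?W" by blast
  obtain y where y: "y \<in> ?W" "\<And>b. b \<in> ?W \<Longrightarrow> cinner (v - y) b = 0"
    using finite_orthogonal_decomposition[of "f ` {..<N}" v] by blast
  define u where "u = of_real (1 / norm (v - y)) *\<^sub>C (v - y)"
  have vy: "v - y \<noteq> 0" using v(1) y(1) by auto
  have "?D y \<in> ?W"
    using schur_basis_invariant[OF T f y(1)] y(1)
    by (intro complex_vector.span_diff complex_vector.span_scale)
  with v(2) have "?D v - ?D y \<in> ?W" by (rule complex_vector.span_diff)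
  then have "of_real (1 / norm (v - y)) *\<^sub>C (?D v - ?D y) \<in> ?W" by (rule complex_vector.span_scale)
  moreover have "of_real (1 / norm (v - y)) *\<^sub>C (?D v - ?D y) = ?D u"
    by (simp add: u_def clinear_diff[OF T] clinear_scaleC[OF T] complex_vector.scale_right_diff_distrib
        scaleC_scaleC mult.commute)
  ultimately have Du: "?D u \<in> ?W" by simp
  have u: "norm u = 1" using vy by (simp add: u_def norm_scaleC norm_divide)
  have orth: "cinner u (f i) = 0" if "i < N" for i
    using y(2)[of "f i"] that by (simp add: u_def cinner_scaleC_left complex_vector.span_base)
  define g where "g i = (if i = N then u else f i)" for i
  have g_image: "g ` {..<k} = f ` {..<k}" if "k \<le> N" for k
    using that by (intro image_cong) (auto simp: g_def)
  have "schur_basis T l (Suc N) g"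
    unfolding schur_basis_def
  proof (intro conjI allI impI)
    show "orthonormal_upto (Suc N) g"
    proof (rule orthonormal_uptoI)
      show "norm (g i) = 1" if "i < Suc N" for i
        using that u f norm_eq_1_iff_cinner[of "f i"] by (auto simp: g_def schur_basis_def orthonormal_upto_def)
      show "cinner (g i) (g j) = 0" if "j < i" "i < Suc N" for i j
        using that orth f by (auto simp: g_def schur_basis_def orthonormal_upto_def)
    qed
    show "T (g k) - l k *\<^sub>C g k \<in> cspan (g ` {..<k})" if "k < Suc N" for k
    proof (cases "k = N")
      case True
      then show ?thesis using Du g_image[of N] by (simp add: g_def)
    next
      case False
      then show ?thesis using that f g_image[of k] by (simp add: g_def schur_basis_def)
    qed
  qed
  then show ?thesis by blast
qed

text \<open>
  The hypothesis says that \<open>l\<close> lists no eigenvalue more often than its multiplicity allows; the listed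
  values occur in any order and the list may stop before a multiplicity is exhausted.
\<close>

lemma schur_basis_exists:
  assumes T: "clinear T"
    and mult: "\<And>k. k < N \<Longrightarrow> card {j. j < k \<and> l j = l k} < algebraic_multiplicity T (l k)"
  shows "\<exists>f. schur_basis T l N f"
  using mult
proof (induction N)
  case 0
  show ?case by (simp add: schur_basis_def orthonormal_upto_def)
next
  case (Suc N)
  then obtain f where f: "schur_basis T l N f" by auto
  have "\<not> generalised_eigenspace T (l N) \<subseteq> cspan (f ` {..<N})"
  proof
    assume sub: "generalised_eigenspace T (l N) \<subseteq> cspan (f ` {..<N})"
    obtain B where B: "finite B" "card B \<le> card {j. j < N \<and> l j = l N}"
      "generalised_eigenspace T (l N) \<inter> cspan (f ` {..<N}) \<subseteq> cspan B"
      using generalised_eigenspace_schur[OF T f] by blast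
    have "algebraic_multiplicity T (l N) = complex_vector.dim (generalised_eigenspace T (l N))"
      by (simp add: algebraic_multiplicity_def generalised_eigenspace_def)
    also have "\<dots> \<le> card B"
      using B sub by (intro complex_vector.dim_le_card) auto
    finally show False using B(2) Suc.prems[of N] by simp
  qed
  with schur_basis_extend[OF T f] show ?case by blast
qed

section \<open>Weyl's product inequality\<close>

text \<open>
  At step \<open>m\<close> the new vector has to be orthogonal to the \<open>m\<close> previous ones and to \<open>N - 1 - m\<close>
  vectors \<open>w j\<close>, which are \<open>N - 1\<close> conditions in an \<open>N\<close>-dimensional space.
\<close>

lemma orthonormal_adapted:
  assumes f: "orthonormal_upto N f"
  shows "\<exists>h. orthonormal_upto N h \<and> (\<forall>m<N. h m \<in> cspan (f ` {..<N})) \<and>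
    (\<forall>m j. Suc (m + j) < N \<longrightarrow> cinner (h m) (w j) = 0)"
proof -
  define Q where "Q h m u \<longleftrightarrow> m < N \<longrightarrow> norm u = 1 \<and> u \<in> cspan (f ` {..<N}) \<and>
    (\<forall>i<m. cinner u (h i) = 0) \<and> (\<forall>j. Suc (m + j) < N \<longrightarrow> cinner u (w j) = 0)"
    for h :: "nat \<Rightarrow> 'a" and m u
  have "\<exists>h. \<forall>m. Q h m (h m)"
  proof (rule dependent_wellorder_choice[of Q])
    show "Q h m u = Q h' m u" if "\<And>i. i < m \<Longrightarrow> h i = h' i" for h h' m u
      using that by (simp add: Q_def)
    show "\<exists>u. Q h m u" for h m
    proof (cases "m < N")
      case True
      let ?W = "h ` {..<m} \<union> w ` {..<N - Suc m}"
      have "card ?W \<le> card (h ` {..<m}) + card (w ` {..<N - Suc m})" by (rule card_Un_le)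
      also have "\<dots> \<le> m + (N - Suc m)"
        using card_image_le[of "{..<m}" h] card_image_le[of "{..<N - Suc m}" w] by simp
      also have "\<dots> < N" using True by simp
      finally have "card ?W < N" .
      then obtain u where u: "norm u = 1" "u \<in> cspan (f ` {..<N})" "\<And>v. v \<in> ?W \<Longrightarrow> cinner u v = 0"
        using unit_vector_orthogonal_to_few[OF f, of ?W] by blast
      have "Q h m u" unfolding Q_def
      proof (intro impI conjI allI u(1,2))
        show "cinner u (h i) = 0" if "i < m" for i using that by (intro u(3)) auto
        show "cinner u (w j) = 0" if "Suc (m + j) < N" for j using that by (intro u(3)) auto
      qed
      then show ?thesis by blast
    qed (simp add: Q_def)
  qed
  then obtain h where h: "\<And>m. Q h m (h m)" by blast
  have "orthonormal_upto N h"
    using h by (intro orthonormal_uptoI) (auto simp: Q_def)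
  with h show ?thesis by (intro exI[of _ h]) (auto simp: Q_def)
qed

lemma cmod_det_orthonormal_change:
  assumes f: "orthonormal_upto N f" and g: "orthonormal_upto N g"
    and sub: "\<And>i. i < N \<Longrightarrow> g i \<in> cspan (f ` {..<N})"
  shows "cmod (det (mat N N (\<lambda>(i, j). cinner (g j) (f i)))) = 1" (is "cmod (det ?U) = 1")
    and "cmod (det (mat N N (\<lambda>(i, j). cinner (f j) (g i)))) = 1" (is "cmod (det ?V) = 1")
proof -
  interpret cnj: comm_ring_hom cnj by unfold_locales auto
  have "?V = transpose_mat (map_mat cnj ?U)"
    by (rule eq_matI) (simp_all add: cinner_commute[symmetric])
  then have "det ?V = cnj (det ?U)"
    by (simp add: det_transpose[of _ N] del: map_mat_transpose)
  then have eq: "cmod (det ?V) = cmod (det ?U)" by simp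
  have "?V * ?U = 1\<^sub>m N"
  proof (rule eq_matI)
    fix i j assume ij: "i < dim_row (1\<^sub>m N :: complex mat)" "j < dim_col (1\<^sub>m N :: complex mat)"
    then have "(?V * ?U) $$ (i, j) = (\<Sum>a<N. cinner (g j) (f a) * cinner (f a) (g i))"
      by (simp add: scalar_prod_def atLeast0LessThan mult.commute)
    also have "\<dots> = cinner (g j) (g i)"
      using ij orthonormal_parseval[OF f sub] by simp
    finally show "(?V * ?U) $$ (i, j) = 1\<^sub>m N $$ (i, j)"
      using ij orthonormal_uptoD[OF g] by auto
  qed auto
  then have "det ?V * det ?U = 1"
    using det_mult[of ?V N ?U] by simp
  then have "cmod (det ?V) * cmod (det ?U) = 1" by (metis norm_mult norm_one)
  then have "(cmod (det ?U))\<^sup>2 = 1" unfolding eq by (simp add: power2_eq_square)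
  then show "cmod (det ?U) = 1" by (simp add: power2_eq_1_iff) (metis norm_ge_zero not_one_le_zero neg_0_le_iff_le)
  with eq show "cmod (det ?V) = 1" by simp
qed

lemma cmod_det_upper_triangular:
  assumes "\<And>i j. j < i \<Longrightarrow> i < N \<Longrightarrow> a i j = (0::complex)"
  shows "cmod (det (mat N N (\<lambda>(i, j). a i j))) = (\<Prod>k<N. cmod (a k k))"
proof -
  let ?A = "mat N N (\<lambda>(i, j). a i j)"
  have "det ?A = prod_list (diag_mat ?A)"
    using assms by (intro det_upper_triangular[of _ N]) auto
  also have "\<dots> = (\<Prod>k<N. a k k)"
    by (simp add: prod_list_diag_prod atLeast0LessThan)
  finally show ?thesis by (simp add: prod_norm)
qed

context schmidt_system
begin

text \<open>
  On the invariant space \<open>V\<close> spanned by the Schur basis \<open>f\<close> there are orthonormal bases \<open>h\<close> and \<open>q\<close>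
  such that \<open>h k\<close> is orthogonal to \<open>e j\<close> for \<open>j < N - 1 - k\<close>, so that
  \<open>norm (T (h k)) \<le> s (N - 1 - k)\<close>, and the matrix \<open>R\<close> of \<open>T\<close> from \<open>h\<close> to \<open>q\<close> is upper
  triangular. Its determinant has the same modulus as that of the matrix \<open>M\<close> of \<open>T\<close> in the basis
  \<open>f\<close>, which is the product of the moduli of the eigenvalues.
\<close>

theorem weyl_product_inequality:
  assumes schur: "schur_basis T l N f"
  shows "(\<Prod>k<N. cmod (l k)) \<le> (\<Prod>k<N. s k)"
proof -
  let ?V = "cspan (f ` {..<N})"
  have f: "orthonormal_upto N f" using schur by (simp add: schur_basis_def)
  obtain h where h: "orthonormal_upto N h" "\<And>m. m < N \<Longrightarrow> h m \<in> ?V"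
    "\<And>m j. Suc (m + j) < N \<Longrightarrow> cinner (h m) (e j) = 0"
    using orthonormal_adapted[OF f, of e] by blast
  obtain q' where q': "orthonormal_upto N q'" "\<And>m. m < N \<Longrightarrow> q' m \<in> ?V"
    "\<And>m j. Suc (m + j) < N \<Longrightarrow> cinner (q' m) (T (h j)) = 0"
    using orthonormal_adapted[OF f, of "\<lambda>j. T (h j)"] by blast
  \<comment> \<open>The reversal turns the orthogonality relations of \<open>q'\<close> into triangularity of \<open>R\<close>.\<close>
  define q where "q m = q' (N - Suc m)" for m
  have q: "orthonormal_upto N q"
    unfolding orthonormal_upto_def
  proof (intro allI impI)
    fix i j assume "i < N" "j < N"
    then show "cinner (q i) (q j) = (if i = j then 1 else 0)"
      using orthonormal_uptoD[OF q'(1), of "N - Suc i" "N - Suc j"] by (auto simp: q_def)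
  qed
  have qV: "q m \<in> ?V" if "m < N" for m using that by (auto simp: q_def intro: q'(2))
  define M where "M i j = cinner (T (f j)) (f i)" for i j
  define R where "R i j = cinner (T (h j)) (q i)" for i j
  let ?M = "mat N N (\<lambda>(i, j). M i j)" and ?R = "mat N N (\<lambda>(i, j). R i j)"
  let ?U = "mat N N (\<lambda>(i, j). cinner (h j) (f i))" and ?Q = "mat N N (\<lambda>(i, j). cinner (f j) (q i))"
  have "?R = ?Q * (?M * ?U)"
  proof (rule eq_matI)
    fix i j assume "i < dim_row (?Q * (?M * ?U))" "j < dim_col (?Q * (?M * ?U))"
    then have ij: "i < N" "j < N" by auto
    have "cinner (T (h j)) (f a) = (\<Sum>b<N. M a b * cinner (h j) (f b))" for a
      by (subst orthonormal_expansion[OF f h(2)[OF ij(2)]])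
        (simp add: clinear_sum[OF T_clinear] clinear_scaleC[OF T_clinear] cinner_sum_left
          cinner_scaleC_left M_def mult.commute)
    moreover have "R i j = (\<Sum>a<N. cinner (T (h j)) (f a) * cinner (f a) (q i))"
      unfolding R_def
      by (rule orthonormal_parseval[OF f schur_basis_invariant[OF T_clinear schur h(2)[OF ij(2)]]])
    ultimately have "R i j = (\<Sum>a<N. cinner (f a) (q i) * (\<Sum>b<N. M a b * cinner (h j) (f b)))"
      by (simp add: mult.commute)
    then show "?R $$ (i, j) = (?Q * (?M * ?U)) $$ (i, j)"
      using ij by (simp add: scalar_prod_def atLeast0LessThan)
  qed auto
  then have "det ?R = det (?Q * (?M * ?U))" by simp
  also have "\<dots> = det ?Q * det (?M * ?U)"
    by (rule det_mult[of _ N]) (auto intro!: mult_carrier_mat[of _ N N])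
  also have "det (?M * ?U) = det ?M * det ?U" by (rule det_mult[of _ N]) auto
  finally have "det ?R = det ?Q * (det ?M * det ?U)" .
  then have det_eq: "cmod (det ?R) = cmod (det ?M)"
    using cmod_det_orthonormal_change(1)[OF f h(1,2)] cmod_det_orthonormal_change(2)[OF f q qV]
    by (simp add: norm_mult)
  have M_triangular: "M i k = (if i = k then l k else 0)" if "k \<le> i" "i < N" for i k
  proof -
    have "T (f k) - l k *\<^sub>C f k \<in> cspan (f ` {..<k})"
      using schur that by (simp add: schur_basis_def)
    moreover have "cinner (f i) b = 0" if "b \<in> f ` {..<k}" for b
      using that \<open>k \<le> i\<close> \<open>i < N\<close> orthonormal_uptoD[OF f] by auto
    ultimately have "cinner (f i) (T (f k) - l k *\<^sub>C f k) = 0"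
      by (rule cinner_cspan_eq_0[rotated])
    then have "cinner (T (f k) - l k *\<^sub>C f k) (f i) = 0" by (simp only: cinner_eq_0_commute)
    then show ?thesis
      using that orthonormal_uptoD[OF f, of k i]
      by (auto simp: M_def cinner_diff_left cinner_scaleC_left)
  qed
  have "(\<Prod>k<N. cmod (l k)) = (\<Prod>k<N. cmod (M k k))" by (simp add: M_triangular)
  also have "\<dots> = cmod (det ?M)"
    by (rule cmod_det_upper_triangular[symmetric]) (simp add: M_triangular)
  also have "\<dots> = (\<Prod>k<N. cmod (R k k))"
    unfolding det_eq[symmetric]
  proof (rule cmod_det_upper_triangular)
    show "R i j = 0" if "j < i" "i < N" for i j
    proof -
      have "cinner (q i) (T (h j)) = 0" unfolding q_def using that by (intro q'(3)) auto
      then show ?thesis unfolding R_def by (simp only: cinner_eq_0_commute)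
    qed
  qed
  also have "\<dots> \<le> (\<Prod>k<N. s (N - Suc k))"
  proof (rule prod_mono, intro conjI)
    fix k assume k: "k \<in> {..<N}"
    have "norm (q k) = 1" "norm (h k) = 1"
      using k orthonormal_uptoD[OF q, of k k] orthonormal_uptoD[OF h(1), of k k]
      by (simp_all add: norm_eq_1_iff_cinner)
    moreover have "norm (T (h k)) \<le> s (N - Suc k) * norm (h k)"
      unfolding s_def by (rule extremal) (use k in \<open>auto intro: h(3)\<close>)
    ultimately show "cmod (R k k) \<le> s (N - Suc k)"
      using cmod_cinner_le[of "T (h k)" "q k"] by (simp add: R_def)
  qed simp
  also have "\<dots> = (\<Prod>k<N. s k)" by (rule prod.nat_diff_reindex)
  finally show ?thesis .
qed

end

section \<open>Existence and decay of eigenvalue sequences\<close>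

text \<open>
  Greedy enumeration: \<open>avail l n\<close> are the values that the first \<open>n\<close> entries have not yet listed as often
  as \<open>m\<close> prescribes, and the next entry is one of largest modulus among them. A value that is never
  listed often enough would keep all entries at least as large as itself in modulus, but only finitely
  many entries are that large.
\<close>

lemma decreasing_enumeration_exists:
  fixes m :: "complex \<Rightarrow> nat"
  assumes fin: "\<And>t. 0 < t \<Longrightarrow> finite {z. t \<le> cmod z \<and> 0 < m z}"
  shows "\<exists>l. l \<longlonglongrightarrow> 0 \<and> decseq (\<lambda>j. cmod (l j)) \<and> (\<forall>z. z \<noteq> 0 \<longrightarrow> card {j. l j = z} = m z)"
proof -
  define avail where "avail l n = {z. z \<noteq> 0 \<and> card {j. j < n \<and> l j = z} < m z}" for l :: "nat \<Rightarrow> complex" and n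
  define Q where "Q l n z \<longleftrightarrow> (if avail l n = {} then z = 0
      else z \<in> avail l n \<and> (\<forall>w\<in>avail l n. cmod w \<le> cmod z))" for l n z
  have "\<exists>l. \<forall>n. Q l n (l n)"
  proof (rule dependent_wellorder_choice[of Q])
    show "Q l n z = Q l' n z" if eq: "\<And>i. i < n \<Longrightarrow> l i = l' i" for l l' n z
    proof -
      have "{j. j < n \<and> l j = w} = {j. j < n \<and> l' j = w}" for w using eq by auto
      then have "avail l n = avail l' n" by (simp add: avail_def)
      then show ?thesis by (simp add: Q_def)
    qed
    show "\<exists>z. Q l n z" for l n
    proof (cases "avail l n = {}")
      case False
      then obtain w where w: "w \<in> avail l n" by blast
      let ?F = "{z \<in> avail l n. cmod w \<le> cmod z}"
      have "finite ?F"
        by (rule finite_subset[OF _ fin[of "cmod w"]]) (use w in \<open>auto simp: avail_def\<close>)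
      moreover have "?F \<noteq> {}" using w by auto
      ultimately have "Max (cmod ` ?F) \<in> cmod ` ?F" by (intro Max_in) auto
      then obtain z where z: "z \<in> ?F" "cmod z = Max (cmod ` ?F)" by auto
      have "cmod v \<le> cmod z" if "v \<in> avail l n" for v
      proof (cases "cmod w \<le> cmod v")
        case True
        with that \<open>finite ?F\<close> show ?thesis unfolding z(2) by (intro Max_ge) auto
      qed (use z in auto)
      with z(1) False show ?thesis by (auto simp: Q_def)
    qed (simp add: Q_def)
  qed
  then obtain l where l: "\<And>n. Q l n (l n)" by blast
  define c where "c n z = card {j. j < n \<and> l j = z}" for n z
  have c_Suc: "c (Suc n) z = (if l n = z then Suc (c n z) else c n z)" for n z
  proof -
    have "{j. j < Suc n \<and> l j = z} = (if l n = z then insert n {j. j < n \<and> l j = z} else {j. j < n \<and> l j = z})"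
      by (auto simp: less_Suc_eq)
    then show ?thesis by (simp add: c_def)
  qed
  have avail_iff: "z \<in> avail l n \<longleftrightarrow> z \<noteq> 0 \<and> c n z < m z" for z n by (simp add: avail_def c_def)
  have avail_Suc: "avail l (Suc n) \<subseteq> avail l n" for n
    by (auto simp: avail_iff c_Suc split: if_splits)
  have l_avail: "l n \<in> avail l n" if "l n \<noteq> 0" for n using l[of n] that by (auto simp: Q_def split: if_splits)
  have l_max: "cmod w \<le> cmod (l n)" if "w \<in> avail l n" for w n
    using l[of n] that by (auto simp: Q_def split: if_splits)
  have c_le: "c n z \<le> m z" if "z \<noteq> 0" for n z
  proof (induction n)
    case (Suc n)
    show ?case
    proof (cases "l n = z")
      case True
      then have "c n z < m z" using l_avail[of n] that by (simp add: avail_iff)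
      then show ?thesis by (simp add: c_Suc True)
    qed (use Suc in \<open>simp add: c_Suc\<close>)
  qed (simp add: c_def)
  have dec: "decseq (\<lambda>j. cmod (l j))"
  proof (rule decseq_SucI)
    fix n
    show "cmod (l (Suc n)) \<le> cmod (l n)"
      using l_max[of "l (Suc n)" n] l_avail[of "Suc n"] avail_Suc[of n] by (cases "l (Suc n) = 0") auto
  qed
  have fin_level: "finite {j. l j = z}" "card {j. l j = z} \<le> m z" if "z \<noteq> 0" for z
  proof -
    have bound: "card F \<le> m z" if F: "F \<subseteq> {j. l j = z}" "finite F" for F
    proof -
      have "F \<subseteq> {j. j < Suc (Max F) \<and> l j = z}"
        using F by (auto simp: less_Suc_eq_le)
      then have "card F \<le> c (Suc (Max F)) z" unfolding c_def by (intro card_mono) auto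
      also have "\<dots> \<le> m z" using \<open>z \<noteq> 0\<close> by (rule c_le)
      finally show ?thesis .
    qed
    then show "finite {j. l j = z}" using finite_if_finite_subsets_card_bdd by blast
    then show "card {j. l j = z} \<le> m z" using bound by blast
  qed
  have fin_large: "finite {j. t \<le> cmod (l j)}" if t: "t > 0" for t
  proof -
    have "{j. t \<le> cmod (l j)} \<subseteq> (\<Union>z\<in>{z. t \<le> cmod z \<and> 0 < m z}. {j. l j = z})"
    proof
      fix j assume j: "j \<in> {j. t \<le> cmod (l j)}"
      then have "l j \<noteq> 0" using t by auto
      then have "0 < m (l j)" using l_avail[of j] by (auto simp: avail_iff)
      with j show "j \<in> (\<Union>z\<in>{z. t \<le> cmod z \<and> 0 < m z}. {j. l j = z})" by auto
    qed
    moreover have "finite (\<Union>z\<in>{z. t \<le> cmod z \<and> 0 < m z}. {j. l j = z})"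
    proof (rule finite_UN_I[OF fin[OF t]], rule fin_level(1))
      show "z \<noteq> 0" if "z \<in> {z. t \<le> cmod z \<and> 0 < m z}" for z using that t by auto
    qed
    ultimately show ?thesis by (rule finite_subset)
  qed
  have "l \<longlonglongrightarrow> 0"
  proof (rule tendstoI)
    fix t :: real assume "t > 0"
    from fin_large[OF this] obtain n where "\<And>j. t \<le> cmod (l j) \<Longrightarrow> j < n"
      by (auto simp: finite_nat_iff_bounded)
    then show "eventually (\<lambda>j. dist (l j) 0 < t) sequentially"
      unfolding eventually_sequentially by (intro exI[of _ n]) (auto simp: not_le[symmetric])
  qed
  moreover have "card {j. l j = z} = m z" if z: "z \<noteq> 0" for z
  proof (rule ccontr)
    assume "card {j. l j = z} \<noteq> m z"
    then have less: "card {j. l j = z} < m z" using fin_level(2)[OF z] by simp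
    have "cmod z \<le> cmod (l n)" for n
    proof (rule l_max)
      have "c n z \<le> card {j. l j = z}"
        unfolding c_def by (rule card_mono[OF fin_level(1)[OF z]]) auto
      then show "z \<in> avail l n" using less z by (simp add: avail_iff)
    qed
    then have "{j. cmod z \<le> cmod (l j)} = UNIV" by blast
    with fin_large[of "cmod z"] z show False by simp
  qed
  ultimately show ?thesis using dec by blast
qed

lemma power_le_exp_fact: "real n ^ n \<le> exp (real n) * fact n"
proof -
  have "(\<Sum>k\<in>{n}. inverse (fact k) * real n ^ k) \<le> (\<Sum>k. inverse (fact k) * real n ^ k)"
    using summable_exp[of "real n"] by (intro sum_le_suminf) auto
  then have "inverse (fact n) * real n ^ n \<le> exp (real n)"
    by (simp add: exp_def scaleR_conv_of_real)
  then show ?thesis by (simp add: field_simps)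
qed

text \<open>
  If the singular values are at most \<open>C / (k + 1)\<close>, the product inequality bounds \<open>t ^ N\<close> by
  \<open>C ^ N / fact N\<close>, and \<open>fact N \<ge> (N / exp 1) ^ N\<close> turns this into \<open>t \<le> exp 1 * C / N\<close>.
\<close>

lemma weyl_bound:
  assumes T: "compact_operator T"
    and C: "\<And>k. singular_value T k \<le> C / real (Suc k)"
    and schur: "schur_basis T l N f" and t: "0 \<le> t" "\<And>k. k < N \<Longrightarrow> t \<le> cmod (l k)"
  shows "real N * t \<le> exp 1 * C"
proof (cases "N = 0")
  case True
  obtain e where "schmidt_system T e" using schmidt_system_exists[OF T] by blast
  then interpret schmidt_system T e .
  have "0 \<le> C" using C[of 0] s_nonneg[of 0] by (simp add: singular_value_eq)
  with True show ?thesis by simp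
next
  case False
  obtain e where "schmidt_system T e" using schmidt_system_exists[OF T] by blast
  then interpret schmidt_system T e .
  have s: "s k \<le> C / real (Suc k)" for k using C[of k] by (simp add: singular_value_eq)
  have C0: "0 \<le> C" using s[of 0] s_nonneg[of 0] by simp
  have "t ^ N \<le> (\<Prod>k<N. cmod (l k))"
    using t prod_mono[of "{..<N}" "\<lambda>_. t" "\<lambda>k. cmod (l k)"] by simp
  also have "\<dots> \<le> (\<Prod>k<N. s k)" by (rule weyl_product_inequality[OF schur])
  also have "\<dots> \<le> (\<Prod>k<N. C / real (Suc k))" using s s_nonneg by (intro prod_mono) auto
  also have "\<dots> = C ^ N / fact N"
    by (simp add: prod_dividef fact_prod_Suc atLeast0LessThan)
  finally have "t ^ N * fact N \<le> C ^ N" by (simp add: field_simps)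
  have "(real N * t) ^ N \<le> (exp (real N) * fact N) * t ^ N"
    unfolding power_mult_distrib using t by (intro mult_right_mono power_le_exp_fact) auto
  also have "\<dots> \<le> exp (real N) * C ^ N"
    using \<open>t ^ N * fact N \<le> C ^ N\<close> by (simp add: mult.commute mult.left_commute)
  also have "\<dots> = (exp 1 * C) ^ N"
    by (simp add: power_mult_distrib exp_of_nat_mult[symmetric])
  finally show ?thesis using False C0 t by (simp add: power_mono_iff)
qed

lemma singular_value_bound:
  assumes "A \<in> weak_trace_class"
  obtains C where "\<And>k. singular_value A k \<le> C / real (Suc k)"
proof -
  have A: "compact_operator A" "singular_value A \<in> O(\<lambda>j. 1 / real j)"
    using assms by (auto simp: weak_trace_class_def)
  obtain c where "eventually (\<lambda>j. norm (singular_value A j) \<le> c * norm (1 / real j)) sequentially"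
    using A(2) by (auto elim!: landau_o.bigE)
  then obtain n where n: "\<And>j. j \<ge> n \<Longrightarrow> \<bar>singular_value A j\<bar> \<le> c / real j"
    by (auto simp: eventually_sequentially)
  define C where "C = 2 * \<bar>c\<bar> + (\<Sum>j\<le>n. \<bar>singular_value A j\<bar> * real (Suc j))"
  have "singular_value A k \<le> C / real (Suc k)" for k
  proof -
    have "\<bar>singular_value A k\<bar> * real (Suc k) \<le> C"
    proof (cases "k \<le> n")
      case True
      then have "\<bar>singular_value A k\<bar> * real (Suc k) \<le> (\<Sum>j\<le>n. \<bar>singular_value A j\<bar> * real (Suc j))"
        by (intro member_le_sum) auto
      then show ?thesis by (simp add: C_def)
    next
      case False
      then have k: "k \<ge> 1" "k \<ge> n" by auto
      have "\<bar>singular_value A k\<bar> * real (Suc k) \<le> (\<bar>c\<bar> / real k) * (2 * real k)"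
        using n[OF k(2)] k
        by (intro mult_mono) (auto intro: order_trans[OF _ divide_right_mono[of c "\<bar>c\<bar>"]])
      also have "\<dots> = 2 * \<bar>c\<bar>" using k by simp
      also have "\<dots> \<le> C" unfolding C_def by (simp add: sum_nonneg)
      finally show ?thesis .
    qed
    then have "\<bar>singular_value A k\<bar> \<le> C / real (Suc k)" by (simp add: pos_le_divide_eq)
    then show ?thesis by linarith
  qed
  with that show ?thesis by blast
qed

text \<open>
  Finitely many distinct eigenvalues of modulus at least \<open>t\<close> form the diagonal of a Schur basis, so
  their number is at most \<open>exp 1 * C / t\<close>.
\<close>

lemma eigenvalue_sequence_exists:
  assumes A: "A \<in> weak_trace_class"
  shows "\<exists>l. eigenvalue_sequence A l"
  unfolding eigenvalue_sequence_def
proof (rule decreasing_enumeration_exists)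
  fix t :: real assume t: "0 < t"
  have compact: "compact_operator A" using A by (simp add: weak_trace_class_def)
  obtain C where C: "\<And>k. singular_value A k \<le> C / real (Suc k)" using singular_value_bound[OF A] by blast
  let ?Z = "{z. t \<le> cmod z \<and> 0 < algebraic_multiplicity A z}"
  have "card F \<le> nat \<lfloor>exp 1 * C / t\<rfloor>" if F: "F \<subseteq> ?Z" "finite F" for F
  proof -
    obtain l where l: "bij_betw l {..<card F} F"
      using ex_bij_betw_nat_finite[OF F(2)] by (auto simp: atLeast0LessThan)
    have lZ: "l k \<in> ?Z" if "k < card F" for k using bij_betwE[OF l] that F(1) by auto
    have distinct: "{j. j < k \<and> l j = l k} = {}" if "k < card F" for k
      using bij_betw_imp_inj_on[OF l] that by (auto simp: inj_on_def)
    obtain f where f: "schur_basis A l (card F) f"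
      using schur_basis_exists[of A "card F" l] compact lZ distinct
      by (auto simp: compact_operator_def)
    have "real (card F) * t \<le> exp 1 * C"
      by (rule weyl_bound[OF compact C f]) (use t lZ in auto)
    then show ?thesis using t by (simp add: field_simps le_nat_floor)
  qed
  then show "finite ?Z" using finite_if_finite_subsets_card_bdd by blast
qed

lemma eigenvalue_sequence_bound:
  assumes A: "A \<in> weak_trace_class"
  obtains K where "\<And>l n. eigenvalue_sequence A l \<Longrightarrow> real (Suc n) * cmod (l n) \<le> K"
proof -
  have compact: "compact_operator A" using A by (simp add: weak_trace_class_def)
  obtain C where C: "\<And>k. singular_value A k \<le> C / real (Suc k)" using singular_value_bound[OF A] by blast
  have "real (Suc n) * cmod (l n) \<le> exp 1 * C" if l: "eigenvalue_sequence A l" for l n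
  proof (cases "l n = 0")
    case True
    have "schur_basis A l 0 f" for f by (simp add: schur_basis_def orthonormal_upto_def)
    from weyl_bound[OF compact C this, of 0] True show ?thesis by simp
  next
    case False
    have ge: "cmod (l n) \<le> cmod (l k)" if "k < Suc n" for k
      using l that by (auto simp: eigenvalue_sequence_def decseq_def)
    have "card {j. j < k \<and> l j = l k} < algebraic_multiplicity A (l k)" if "k < Suc n" for k
    proof -
      have lk: "l k \<noteq> 0" using ge[OF that] False by auto
      have "finite {j. l j = l k}"
        by (rule finite_subset[OF _ eigenvalue_sequence_finite[OF l, of "cmod (l k)"]]) (use lk in auto)
      then have "card {j. j < k \<and> l j = l k} < card {j. l j = l k}"
        by (rule psubset_card_mono) auto
      then show ?thesis using l lk by (simp add: eigenvalue_sequence_def)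
    qed
    then obtain f where "schur_basis A l (Suc n) f"
      using schur_basis_exists[of A "Suc n" l] compact by (auto simp: compact_operator_def)
    then show ?thesis by (rule weyl_bound[OF compact C]) (use ge in auto)
  qed
  with that show ?thesis by blast
qed

section \<open>Logarithmic means of eigenvalues\<close>

text \<open>
  The entries of modulus larger than that of \<open>l N\<close> all have index below \<open>N\<close> and have the same sum in
  both sequences. The other entries below \<open>N\<close> have the modulus of \<open>l N\<close>.
\<close>

lemma eigenvalue_sequence_partial_sums:
  assumes l: "eigenvalue_sequence A l" and l': "eigenvalue_sequence A l'"
  shows "cmod ((\<Sum>j<N. l j) - (\<Sum>j<N. l' j)) \<le> 2 * real N * cmod (l N)"
proof -
  define r where "r = cmod (l N)"
  let ?J = "{j. r < cmod (l j)}"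
  have cmod_eq: "cmod (l j) = cmod (l' j)" for j by (rule eigenvalue_sequence_cmod_eq[OF l l'])
  have J: "?J \<subseteq> {..<N}"
  proof
    fix j assume "j \<in> ?J"
    then have "\<not> N \<le> j" using l by (auto simp: r_def eigenvalue_sequence_def decseq_def not_le[symmetric])
    then show "j \<in> {..<N}" by simp
  qed
  then have fin: "finite ?J" by (rule finite_subset) simp
  have r: "r \<ge> 0" by (simp add: r_def)
  have "(\<Sum>j\<in>?J. l j) = (\<Sum>j\<in>?J. l' j)"
    using eigenvalue_sequence_sum[OF l, of "{z. r < cmod z}" "\<lambda>z. z"]
      eigenvalue_sequence_sum[OF l', of "{z. r < cmod z}" "\<lambda>z. z"] fin r
    by (simp add: cmod_eq)
  then have "(\<Sum>j<N. l j) - (\<Sum>j<N. l' j) = (\<Sum>j\<in>{..<N} - ?J. l j - l' j)"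
    by (simp add: sum_subtractf sum_diff[OF _ J])
  also have "cmod \<dots> \<le> (\<Sum>j\<in>{..<N} - ?J. 2 * r)"
  proof (rule sum_norm_le)
    fix j assume "j \<in> {..<N} - ?J"
    then have "cmod (l j) \<le> r" "cmod (l' j) \<le> r" by (auto simp: cmod_eq[symmetric])
    then show "cmod (l j - l' j) \<le> 2 * r" using norm_triangle_ineq4[of "l j" "l' j"] by simp
  qed
  also have "\<dots> \<le> real N * (2 * r)"
    using r card_mono[of "{..<N}" "{..<N} - ?J"] by (simp add: mult_right_mono)
  finally show ?thesis by (simp add: r_def)
qed

lemma log_mean_diff_tendsto_0:
  assumes A: "A \<in> weak_trace_class"
    and l: "eigenvalue_sequence A l" and l': "eigenvalue_sequence A l'"
  shows "(\<lambda>N. log_mean l N - log_mean l' N) \<longlonglongrightarrow> 0"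
proof -
  obtain K where K: "\<And>l n. eigenvalue_sequence A l \<Longrightarrow> real (Suc n) * cmod (l n) \<le> K"
    using eigenvalue_sequence_bound[OF A] by blast
  show ?thesis
  proof (rule Lim_null_comparison)
    have "cmod (log_mean l N - log_mean l' N) \<le> 2 * K / ln (real N)" if "N \<ge> 2" for N
    proof -
      have "real N * cmod (l N) \<le> real (Suc N) * cmod (l N)" by (intro mult_right_mono) auto
      then have "2 * real N * cmod (l N) \<le> 2 * K" using K[OF l, of N] by linarith
      with eigenvalue_sequence_partial_sums[OF l l', of N]
      have "cmod ((\<Sum>j<N. l j) - (\<Sum>j<N. l' j)) \<le> 2 * K" by linarith
      moreover have "log_mean l N - log_mean l' N = ((\<Sum>j<N. l j) - (\<Sum>j<N. l' j)) / of_real (ln (real N))"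
        by (simp add: log_mean_def diff_divide_distrib)
      ultimately show ?thesis using that by (simp add: norm_divide divide_right_mono)
    qed
    then show "eventually (\<lambda>N. cmod (log_mean l N - log_mean l' N) \<le> 2 * K / ln (real N)) sequentially"
      unfolding eventually_sequentially by blast
    have "filterlim (\<lambda>N. ln (real N)) at_top sequentially"
      using filterlim_compose[OF ln_at_top filterlim_real_sequentially] .
    then show "(\<lambda>N. 2 * K / ln (real N)) \<longlonglongrightarrow> 0"
      by (intro tendsto_divide_0[OF tendsto_const] filterlim_at_top_imp_at_infinity)
  qed
qed

theorem theorem2p17:
  fixes A :: "'a::complex_hilbert_space \<Rightarrow> 'a"
  assumes "separable_space (euclidean :: 'a topology)"
    and "A \<in> weak_trace_class"
  shows "(nc_measurable A \<longleftrightarrow> tauberian A) \<and>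
    (nc_measurable A \<longrightarrow>
      (\<forall>l. eigenvalue_sequence A l \<longrightarrow> log_mean l \<longlonglongrightarrow> nc_integral A))"
proof -
  note A = assms(2)
  define L where "L = some_eigenvalue_sequence A"
  have L: "eigenvalue_sequence A L"
    unfolding L_def some_eigenvalue_sequence_def
    by (rule someI_ex[OF eigenvalue_sequence_exists[OF A]])
  have transfer: "log_mean l \<longlonglongrightarrow> c" if "log_mean l' \<longlonglongrightarrow> c" "eigenvalue_sequence A l" "eigenvalue_sequence A l'"
    for l l' c
    using tendsto_add[OF log_mean_diff_tendsto_0[OF A that(2,3)] that(1)] by simp
  have trace: "dixmier_trace \<omega> A = \<omega> (\<lambda>n. log_mean L (Suc n))" for \<omega>
    by (simp add: dixmier_trace_def L_def)
  have integral: "log_mean L \<longlonglongrightarrow> nc_integral A" if "nc_measurable A"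
  proof -
    have "convergent (\<lambda>n. log_mean L (Suc n))"
      using that by (intro convergent_if_extended_limits_agree) (auto simp: nc_measurable_def trace)
    then obtain c where c: "(\<lambda>n. log_mean L (Suc n)) \<longlonglongrightarrow> c" by (auto simp: convergent_def)
    then have trace_eq: "dixmier_trace \<omega> A = c" if "extended_limit \<omega>" for \<omega>
      unfolding trace using that by (intro extended_limit_convergent)
    have "nc_integral A = c"
      unfolding nc_integral_def using extended_limit_exists trace_eq by (intro the_equality) auto
    with c show ?thesis by (simp add: filterlim_sequentially_Suc)
  qed
  have "nc_measurable A" if "tauberian A"
  proof -
    obtain l c where "eigenvalue_sequence A l" "log_mean l \<longlonglongrightarrow> c"
      using \<open>tauberian A\<close> by (auto simp: tauberian_def convergent_def)
    then have "log_mean L \<longlonglongrightarrow> c" using transfer L by blast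
    then have "(\<lambda>n. log_mean L (Suc n)) \<longlonglongrightarrow> c" by (rule LIMSEQ_Suc)
    then show ?thesis unfolding nc_measurable_def trace using extended_limit_convergent by metis
  qed
  moreover have "tauberian A" if "nc_measurable A"
    using integral[OF that] L unfolding tauberian_def convergent_def by blast
  ultimately show ?thesis using integral transfer L by blast
qed

end
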